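(* Let $X_1,\ldots,X_n$ be independent centered real random variables with densities and with variance $1$, such that each $X_i$ has a Stein factor $\tau_i(X_i)$ and a score function $\rho_i(X_i)$. Let $W_n=\frac{1}{\sqrt{n}}\sum_{i=1}^n X_i$. Then $$\mathcal{J}(W_n)=\sup_{\varphi\in\mathcal{H}(W_n)}\left(E\left[\varphi'(W_n)-W_n\varphi(W_n)\right]\right)^2,$$ where the supremum is taken over the collection $\mathcal{H}(W_n)$ of functions $\varphi$ such that $E[\varphi(W_n)]=0$ and $E[\varphi(W_n)^2]\le 1$.
   Context: Densities are with respect to Lebesgue measure. The score of a real random variable $X$ is the random variable $\rho_X(X)$ satisfying $E[\rho_X(X)\varphi(X)]=-E[\varphi'(X)]$ for all test functions $\varphi\in C_c^\infty(\mathbb{R})$. A Stein factor (one-dimensional Stein matrix) of $X$ is a random variable $\tau_X(X)$ satisfying $E[\tau_X(X)\varphi'(X)]=E[X\varphi(X)]$ for all test functions $\varphi\in C_c^\infty(\mathbb{R})$. Here $\rho_i=\rho_{X_i}$ and $\tau_i=\tau_{X_i}$. For a centered random variable $V$ with variance $1$ and score $\rho_V(V)$, the relative Fisher information is $\mathcal{J}(V)=E[(\rho_V(V)+V)^2]$. For a random variable $Y$, $\mathcal{H}(Y)$ denotes the collection of functions $\varphi$ such that $E[\varphi(Y)]=0$ and $E[\varphi(Y)^2]\le 1$. *)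

theory Defs
  imports "HOL-Probability.Probability"
begin

definition test_function :: "(real \<Rightarrow> real) \<Rightarrow> bool" where
  "test_function \<phi> \<longleftrightarrow>
     (\<forall>k x. (deriv ^^ k) \<phi> differentiable (at x)) \<and> compact (closure {x. \<phi> x \<noteq> 0})"

text \<open>
  Integrability of the score and of the Stein factor is required explicitly, because the
  Bochner integral of a non-integrable function is 0. It makes all the expectations below
  exist, test functions and their derivatives being bounded.
\<close>

definition is_score :: "'a measure \<Rightarrow> ('a \<Rightarrow> real) \<Rightarrow> (real \<Rightarrow> real) \<Rightarrow> bool" where
  "is_score M V \<rho> \<longleftrightarrow>
     \<rho> \<in> borel_measurable borel \<and>
     integrable M (\<lambda>\<omega>. \<rho> (V \<omega>)) \<and>
     (\<forall>\<phi>. test_function \<phi> \<longrightarrow>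
        (\<integral>\<omega>. \<rho> (V \<omega>) * \<phi> (V \<omega>) \<partial>M) = - (\<integral>\<omega>. deriv \<phi> (V \<omega>) \<partial>M))"

definition is_stein_factor :: "'a measure \<Rightarrow> ('a \<Rightarrow> real) \<Rightarrow> (real \<Rightarrow> real) \<Rightarrow> bool" where
  "is_stein_factor M V \<tau> \<longleftrightarrow>
     \<tau> \<in> borel_measurable borel \<and>
     integrable M (\<lambda>\<omega>. \<tau> (V \<omega>)) \<and>
     (\<forall>\<phi>. test_function \<phi> \<longrightarrow>
        (\<integral>\<omega>. \<tau> (V \<omega>) * deriv \<phi> (V \<omega>) \<partial>M) = (\<integral>\<omega>. V \<omega> * \<phi> (V \<omega>) \<partial>M))"

text \<open>
  Any two scores of a random variable agree almost everywhere with respect to its law, so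
  the choice below is immaterial. It is meaningful only when a score exists.
\<close>

definition score :: "'a measure \<Rightarrow> ('a \<Rightarrow> real) \<Rightarrow> real \<Rightarrow> real" where
  "score M V = (SOME \<rho>. is_score M V \<rho>)"

text \<open>Valued in \<open>[0, \<infinity>]\<close>, since an integrable score need not be square-integrable.\<close>

definition relative_fisher_information :: "'a measure \<Rightarrow> ('a \<Rightarrow> real) \<Rightarrow> ennreal" where
  "relative_fisher_information M V =
     (\<integral>\<^sup>+\<omega>. ennreal ((score M V (V \<omega>) + V \<omega>)\<^sup>2) \<partial>M)"

text \<open>
  Differentiability and the existence of the expectations are what
  \<open>E[\<phi>'(Y) - Y \<phi>(Y)]\<close> needs in order to make sense, when \<open>Y\<close> is square-integrable. Regularity
  cannot be dropped altogether: a step function has \<open>\<phi>' = 0\<close> almost everywhere. Compact support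
  is not imposed.
\<close>

definition stein_class :: "'a measure \<Rightarrow> ('a \<Rightarrow> real) \<Rightarrow> (real \<Rightarrow> real) set" where
  "stein_class M Y =
     {\<phi>. (\<forall>x. \<phi> differentiable (at x)) \<and>
         integrable M (\<lambda>\<omega>. \<phi> (Y \<omega>)) \<and>
         integrable M (\<lambda>\<omega>. (\<phi> (Y \<omega>))\<^sup>2) \<and>
         integrable M (\<lambda>\<omega>. deriv \<phi> (Y \<omega>)) \<and>
         (\<integral>\<omega>. \<phi> (Y \<omega>) \<partial>M) = 0 \<and>
         (\<integral>\<omega>. (\<phi> (Y \<omega>))\<^sup>2 \<partial>M) \<le> 1}"

end

theory Submission
  imports Defs
begin

text \<open>
  If \<open>\<rho>\<close> is a score of \<open>V\<close>, then testing against smooth ramps shows that \<open>f t = - E[\<rho>(V); V > t]\<close> is a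
  density of \<open>V\<close>. Integrating by parts against \<open>f\<close> extends \<open>E[\<rho>(V) \<phi>(V)] = - E[\<phi>'(V)]\<close> from test
  functions to every differentiable \<open>\<phi>\<close> for which the expectations exist. Such a \<open>\<phi>'\<close> need not be
  locally Lebesgue integrable, so the integration by parts is done with the Henstock-Kurzweil
  integral, for which \<open>\<phi>'\<close> always has the primitive \<open>\<phi>\<close>.

  The sum \<open>W\<close> has a score, namely \<open>sqrt n * E[\<rho>\<^sub>1(X\<^sub>1) | W]\<close>. With \<open>h = \<rho> + id\<close>, the functional
  \<open>E[\<phi>'(W) - W \<phi>(W)]\<close> equals \<open>- E[h(W) \<phi>(W)]\<close>, and Cauchy-Schwarz bounds the supremum by
  \<open>E[h(W)\<^sup>2]\<close>. Conversely, if the supremum is \<open>S < \<infinity>\<close>, then \<open>(E[h(W) g(W)])\<^sup>2 \<le> S * E[g(W)\<^sup>2]\<close> for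
  bounded \<open>C\<^sup>1\<close> functions \<open>g\<close>, hence by limits for bounded Borel ones. Truncations \<open>g\<close> of \<open>h\<close> then
  give \<open>E[h(W)\<^sup>2] \<le> S\<close>, without presupposing that \<open>h(W)\<close> is square integrable.
\<close>

section \<open>Smooth functions\<close>

definition smooth :: "(real \<Rightarrow> real) \<Rightarrow> bool" where
  "smooth f \<longleftrightarrow> (\<forall>k x. (deriv ^^ k) f differentiable (at x))"

lemma smooth_higher_deriv:
  assumes "smooth f"
  shows "((deriv ^^ k) f has_real_derivative (deriv ^^ Suc k) f x) (at x)"
  using assms by (simp add: smooth_def DERIV_deriv_iff_real_differentiable)

lemma smoothI_DERIV:
  assumes d: "\<And>x. (f has_real_derivative f' x) (at x)" and s: "smooth f'"
  shows "smooth f"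
  unfolding smooth_def
proof (intro allI)
  fix k x
  have "deriv f = f'" using d by (auto intro: DERIV_imp_deriv)
  then show "(deriv ^^ k) f differentiable (at x)"
    using d s unfolding smooth_def real_differentiable_def
    by (cases k) (auto simp del: funpow.simps(2) simp: funpow_Suc_right)
qed

lemma smooth_add:
  assumes f: "smooth f" and g: "smooth g"
  shows "smooth (\<lambda>x. f x + g x)"
proof -
  have "(deriv ^^ k) (\<lambda>x. f x + g x) = (\<lambda>x. (deriv ^^ k) f x + (deriv ^^ k) g x)" for k
  proof (induction k)
    case (Suc k)
    show ?case
      unfolding funpow.simps o_def Suc
      using smooth_higher_deriv[OF f, of k] smooth_higher_deriv[OF g, of k]
      by (auto intro!: ext DERIV_imp_deriv derivative_intros)
  qed simp
  then show ?thesis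
    using f g by (simp add: smooth_def)
qed

lemma smooth_affine:
  assumes f: "smooth f"
  shows "smooth (\<lambda>x. c * f (m * x + b))"
proof -
  have D: "((\<lambda>x. a * (deriv ^^ k) f (m * x + b)) has_real_derivative
      a * m * (deriv ^^ Suc k) f (m * x + b)) (at x)" for a k x
  proof -
    have "((\<lambda>x. (deriv ^^ k) f (m * x + b)) has_real_derivative (deriv ^^ Suc k) f (m * x + b) * m) (at x)"
      by (rule DERIV_chain2[OF smooth_higher_deriv[OF f]]) (auto intro!: derivative_eq_intros)
    from DERIV_cmult[OF this, of a] show ?thesis by (simp add: mult_ac)
  qed
  have "(deriv ^^ k) (\<lambda>x. c * f (m * x + b)) = (\<lambda>x. c * m ^ k * (deriv ^^ k) f (m * x + b))" for k
  proof (induction k)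
    case (Suc k)
    show ?case
      unfolding funpow.simps o_def Suc
      using D[of "c * m ^ k" k] by (auto intro!: ext DERIV_imp_deriv simp: mult_ac)
  qed simp
  then show ?thesis
    unfolding smooth_def using D by (metis real_differentiable_def)
qed

section \<open>Flat functions and bumps built from exp(-1/x)\<close>

definition flat_exp :: "nat \<Rightarrow> real \<Rightarrow> real" where
  "flat_exp n x = (if x \<le> 0 then 0 else inverse x ^ n * exp (- inverse x))"

text \<open>Keeping all powers \<open>n\<close> makes the family closed under differentiation up to
  linear combinations, so that smoothness of exp(-1/x) glued to 0 needs no formula for the higher
  derivatives. Away from 0 this is elementary calculus; at 0 the difference quotient from the right
  vanishes because the exponential beats every power.\<close>

lemma flat_exp_DERIV:
  "(flat_exp n has_real_derivative flat_exp (n + 2) x - real n * flat_exp (n + 1) x) (at x)"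
proof -
  consider "x < 0" | "x = 0" | "x > 0" by linarith
  then show ?thesis
  proof cases
    case 1
    have "((\<lambda>x. 0) has_real_derivative flat_exp (n + 2) x - real n * flat_exp (n + 1) x) (at x)"
      using 1 by (auto simp: flat_exp_def)
    then show ?thesis
      by (rule has_field_derivative_transform_within_open[of _ _ _ "{..<0}"])
        (use 1 in \<open>auto simp: flat_exp_def\<close>)
  next
    case 3
    have I: "(inverse has_real_derivative - (inverse x ^ 2)) (at x)"
      using DERIV_inverse[of x UNIV] 3 by (simp add: numeral_2_eq_2)
    have E: "((\<lambda>x. exp (- inverse x)) has_real_derivative exp (- inverse x) * inverse x ^ 2) (at x)"
      using DERIV_fun_exp[OF DERIV_minus[OF I]] by simp
    have "((\<lambda>x. inverse x ^ n * exp (- inverse x)) has_real_derivative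
        flat_exp (n + 2) x - real n * flat_exp (n + 1) x) (at x)"
      using DERIV_mult[OF DERIV_power[OF I, of n] E] 3
      by (cases n) (simp_all add: flat_exp_def algebra_simps power2_eq_square)
    then show ?thesis
      by (rule has_field_derivative_transform_within_open[of _ _ _ "{0<..}"])
        (use 3 in \<open>auto simp: flat_exp_def\<close>)
  next
    case 2
    \<comment> \<open>Division by \<open>h\<close> raises the exponent to \<open>Suc n\<close>; with
      y = 1/h tending to infinity the expression is y^(n+1) / exp y.\<close>
    have *: "((\<lambda>h. inverse h ^ Suc n * exp (- inverse h)) \<longlongrightarrow> (0::real)) (at_right 0)"
      using filterlim_compose[OF tendsto_power_div_exp_0[of "Suc n"] filterlim_inverse_at_top_right]
      by (simp add: exp_minus divide_inverse)
    have "((\<lambda>h. (flat_exp n (0 + h) - flat_exp n 0) / h) \<longlongrightarrow> 0) (at_right 0)"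
      by (rule Lim_transform_eventually[OF *])
        (auto simp: eventually_at_right[of 0 1] flat_exp_def field_simps intro!: exI[of _ 1])
    moreover have "((\<lambda>h. (flat_exp n (0 + h) - flat_exp n 0) / h) \<longlongrightarrow> 0) (at_left 0)"
      by (rule tendsto_eventually) (auto simp: eventually_at_left[of "-1"] flat_exp_def intro!: exI[of _ "-1"])
    ultimately have "((\<lambda>h. (flat_exp n (0 + h) - flat_exp n 0) / h) \<longlongrightarrow> 0) (at 0)"
      using filterlim_split_at by blast
    then show ?thesis
      using 2 by (simp add: DERIV_def flat_exp_def)
  qed
qed

text \<open>A space of functions vanishing outside (0, 1) that contains the standard bump
  (\<open>n = m = 0\<close>) and is stable under differentiation. Stability alone makes its members
  smooth.\<close>

inductive_set bump_span :: "(real \<Rightarrow> real) set" where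
  base: "(\<lambda>x. flat_exp n x * flat_exp m (1 - x)) \<in> bump_span"
| add: "f \<in> bump_span \<Longrightarrow> g \<in> bump_span \<Longrightarrow> (\<lambda>x. f x + g x) \<in> bump_span"
| scale: "f \<in> bump_span \<Longrightarrow> (\<lambda>x. c * f x) \<in> bump_span"

lemma bump_span_DERIV:
  "f \<in> bump_span \<Longrightarrow> \<exists>f'\<in>bump_span. \<forall>x. (f has_real_derivative f' x) (at x)"
proof (induction rule: bump_span.induct)
  case (base n m)
  let ?p = "\<lambda>n m x. flat_exp n x * flat_exp m (1 - x)"
  \<comment> \<open>Product rule: the terms from the factor in \<open>1 - x\<close> have the
    opposite signs to those from the factor in \<open>x\<close>.\<close>
  let ?f' = "\<lambda>x. (?p (n + 2) m x + (- real n) * ?p (n + 1) m x)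
     + ((-1) * ?p n (m + 2) x + real m * ?p n (m + 1) x)"
  have "?f' \<in> bump_span" by (intro bump_span.intros)
  moreover have "((\<lambda>x. ?p n m x) has_real_derivative ?f' x) (at x)" for x
    by (rule derivative_eq_intros flat_exp_DERIV DERIV_chain2[OF flat_exp_DERIV] refl)+
      (simp add: algebra_simps)
  ultimately show ?case by (intro bexI[of _ ?f'] allI)
next
  case (add f g)
  then obtain f' g' where "f' \<in> bump_span" "\<forall>x. (f has_real_derivative f' x) (at x)"
    "g' \<in> bump_span" "\<forall>x. (g has_real_derivative g' x) (at x)" by blast
  then show ?case
    by (intro bexI[of _ "\<lambda>x. f' x + g' x"]) (auto intro: DERIV_add bump_span.add)
next
  case (scale f c)
  then obtain f' where "f' \<in> bump_span" "\<forall>x. (f has_real_derivative f' x) (at x)" by blast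
  then show ?case
    by (intro bexI[of _ "\<lambda>x. c * f' x"]) (auto intro: DERIV_cmult bump_span.scale)
qed

lemma bump_span_smooth:
  assumes "f \<in> bump_span"
  shows "smooth f"
proof -
  have step: "deriv g \<in> bump_span" if g: "g \<in> bump_span" for g
  proof -
    obtain g' where "g' \<in> bump_span" "\<forall>x. (g has_real_derivative g' x) (at x)"
      using bump_span_DERIV[OF g] by blast
    moreover from this have "deriv g = g'" by (auto intro: DERIV_imp_deriv)
    ultimately show ?thesis by simp
  qed
  have "(deriv ^^ k) f \<in> bump_span" for k
    by (induction k) (auto simp: assms step)
  then show ?thesis
    unfolding smooth_def using bump_span_DERIV real_differentiable_def by blast
qed

section \<open>Smooth steps and ramps\<close>

lemma antiderivative_exists:
  fixes f :: "real \<Rightarrow> real"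
  assumes "continuous_on UNIV f"
  obtains F where "\<And>x. (F has_real_derivative f x) (at x)"
  using einterval_antiderivative[of "-\<infinity>" "\<infinity>" f] assms
  by (auto simp: continuous_on_eq_continuous_at has_real_derivative_iff_has_vector_derivative)

lemma DERIV_zero_imp_eq:
  fixes G :: "real \<Rightarrow> real"
  assumes G: "\<And>x. (G has_real_derivative g x) (at x)"
    and "x \<le> y" and 0: "\<And>z. x < z \<Longrightarrow> z < y \<Longrightarrow> g z = 0"
  shows "G x = G y"
proof (cases "x < y")
  case True
  obtain z where "z > x" "z < y" "G y - G x = (y - x) * g z"
    using MVT2[OF True, of G g] G by blast
  then show ?thesis using 0[of z] by simp
qed (use \<open>x \<le> y\<close> in simp)

text \<open>A bump is integrated twice: \<open>B\<close>, its normalised primitive, is a smooth step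
  from 0 to 1, and \<open>K\<close>, the primitive of \<open>B\<close>, is a smoothed
  \<open>max 0 x\<close>. Beyond 1 it runs parallel to the identity with a shift \<open>c\<close>;
  in the rescaled \<open>K (s * x) / s\<close> both the transition zone and the shift disappear as
  \<open>s\<close> grows.\<close>

lemma smooth_ramp_exists:
  obtains K B :: "real \<Rightarrow> real" and c
  where "smooth K" "\<And>x. (K has_real_derivative B x) (at x)"
    "\<And>x. 0 \<le> B x" "\<And>x. B x \<le> 1"
    "\<And>x. x \<le> 0 \<Longrightarrow> K x = 0" "\<And>x. x \<le> 0 \<Longrightarrow> B x = 0"
    "\<And>x. x \<ge> 1 \<Longrightarrow> K x = x - c" "\<And>x. x \<ge> 1 \<Longrightarrow> B x = 1"
proof -
  define \<beta> where "\<beta> = (\<lambda>x. flat_exp 0 x * flat_exp 0 (1 - x))"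
  have \<beta>: "\<beta> \<in> bump_span" unfolding \<beta>_def by (rule bump_span.base)
  have \<beta>0: "\<beta> x \<ge> 0" "0 < x \<Longrightarrow> x < 1 \<Longrightarrow> \<beta> x > 0" "x \<le> 0 \<or> x \<ge> 1 \<Longrightarrow> \<beta> x = 0" for x
    by (auto simp: \<beta>_def flat_exp_def)
  have "continuous_on UNIV \<beta>"
    using bump_span_DERIV[OF \<beta>] by (auto intro!: continuous_at_imp_continuous_on DERIV_isCont)
  then obtain G where G: "\<And>x. (G has_real_derivative \<beta> x) (at x)"
    using antiderivative_exists by metis
  have mono: "G x \<le> G y" if "x \<le> y" for x y
    by (rule DERIV_nonneg_imp_nondecreasing[OF that]) (use G \<beta>0 in blast)
  \<comment> \<open>The mean value point lies inside (0, 1), where the bump is positive, so the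
    normalising constant \<open>G 1 - G 0\<close> is not 0.\<close>
  obtain z where "0 < z" "z < 1" "G 1 - G 0 = (1 - 0) * \<beta> z"
    using MVT2[of 0 1 G \<beta>] G by auto
  then have "G 0 < G 1"
    using \<beta>0(2)[of z] by simp
  have Gl: "G x = G 0" if "x \<le> 0" for x
    by (rule DERIV_zero_imp_eq[OF G that]) (use \<beta>0(3) in auto)
  have Gr: "G x = G 1" if "x \<ge> 1" for x
    by (rule DERIV_zero_imp_eq[OF G that, symmetric]) (use \<beta>0(3) in auto)
  define B where "B = (\<lambda>x. (G x - G 0) / (G 1 - G 0))"
  have BD: "(B has_real_derivative inverse (G 1 - G 0) * \<beta> (1 * x + 0)) (at x)" for x
  proof -
    have "((\<lambda>x. G x - G 0) has_real_derivative \<beta> x - 0) (at x)"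
      by (rule DERIV_diff[OF G DERIV_const])
    from DERIV_cdivide[OF this, of "G 1 - G 0"] show ?thesis
      by (simp add: B_def divide_inverse mult.commute)
  qed
  have "smooth (\<lambda>x. inverse (G 1 - G 0) * \<beta> (1 * x + 0))"
    by (rule smooth_affine[OF bump_span_smooth[OF \<beta>]])
  with BD have Bs: "smooth B" by (rule smoothI_DERIV)
  have Bl: "B x = 0" if "x \<le> 0" for x using Gl[OF that] by (simp add: B_def)
  have Br: "B x = 1" if "x \<ge> 1" for x using Gr[OF that] \<open>G 0 < G 1\<close> by (simp add: B_def)
  have B0: "0 \<le> B x" for x
    using mono[of 0 x] Bl[of x] \<open>G 0 < G 1\<close> by (cases "x \<le> 0") (auto simp: B_def)
  have B1: "B x \<le> 1" for x
    using mono[of x 1] Br[of x] \<open>G 0 < G 1\<close> by (cases "x \<ge> 1") (auto simp: B_def)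
  have "continuous_on UNIV B"
    by (intro continuous_at_imp_continuous_on ballI DERIV_isCont[OF BD])
  then obtain L where L: "\<And>x. (L has_real_derivative B x) (at x)"
    using antiderivative_exists by metis
  define K where "K = (\<lambda>x. L x - L 0)"
  have KD: "(K has_real_derivative B x) (at x)" for x
    using DERIV_diff[OF L[of x] DERIV_const[of "L 0"]] by (simp add: K_def)
  have Kl: "K x = 0" if "x \<le> 0" for x
    using DERIV_zero_imp_eq[OF KD that] Bl by (simp add: K_def)
  \<comment> \<open>\<open>K\<close> and the identity have the same slope to the right of 1, so
    their difference keeps its value at 1; this fixes \<open>c = 1 - K 1\<close>.\<close>
  have Kr: "K x = x - (1 - K 1)" if "x \<ge> 1" for x
  proof -
    have "((\<lambda>x. K x - x) has_real_derivative B x - 1) (at x)" for x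
      by (rule DERIV_diff[OF KD DERIV_ident])
    from DERIV_zero_imp_eq[OF this that] Br show ?thesis by simp
  qed
  show ?thesis
    by (rule that[OF smoothI_DERIV[OF KD Bs] KD B0 B1 Kl Bl Kr Br])
qed

section \<open>Scores and densities\<close>

lemma test_function_iff_smooth:
  "test_function \<phi> \<longleftrightarrow> smooth \<phi> \<and> compact (closure {x. \<phi> x \<noteq> 0})"
  by (simp add: test_function_def smooth_def)

lemma smooth_DERIV:
  "smooth f \<Longrightarrow> (f has_real_derivative deriv f x) (at x)"
  using smooth_higher_deriv[of f 0] by simp

lemma smooth_deriv:
  "smooth f \<Longrightarrow> smooth (deriv f)"
  unfolding smooth_def by (metis comp_apply funpow_Suc_right)

lemma smooth_continuous_on:
  "smooth f \<Longrightarrow> continuous_on A f"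
  by (intro continuous_at_imp_continuous_on ballI DERIV_isCont[OF smooth_DERIV])

lemma smooth_borel_measurable:
  "smooth f \<Longrightarrow> f \<in> borel_measurable borel"
  by (intro borel_measurable_continuous_onI smooth_continuous_on)

text \<open>This is the score identity for the ramp that rises from 0 at \<open>a\<close> to
  \<open>b - a\<close> at \<open>b\<close>, whose slope is the indicator of the interval. The ramp
  has corners and no compact support, so it is approximated by test functions that are bounded
  uniformly together with their derivatives; integrability of the score then allows dominated
  convergence.\<close>

lemma (in prob_space) score_ramp:
  assumes V[measurable]: "random_variable borel V" and \<rho>: "is_score M V \<rho>" and "a \<le> b"
  shows "prob {\<omega>\<in>space M. a < V \<omega> \<and> V \<omega> \<le> b} =
    - expectation (\<lambda>\<omega>. \<rho> (V \<omega>) * (max 0 (V \<omega> - a) - max 0 (V \<omega> - b)))"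
proof -
  have [measurable]: "\<rho> \<in> borel_measurable borel" and \<rho>i: "integrable M (\<lambda>\<omega>. \<rho> (V \<omega>))"
    using \<rho> by (auto simp: is_score_def)
  obtain K B :: "real \<Rightarrow> real" and c where K: "smooth K"
    "\<And>x. (K has_real_derivative B x) (at x)" "\<And>x. 0 \<le> B x" "\<And>x. B x \<le> 1"
    "\<And>x. x \<le> 0 \<Longrightarrow> K x = 0" "\<And>x. x \<le> 0 \<Longrightarrow> B x = 0"
    "\<And>x. x \<ge> 1 \<Longrightarrow> K x = x - c" "\<And>x. x \<ge> 1 \<Longrightarrow> B x = 1"
    by (rule smooth_ramp_exists) blast
  \<comment> \<open>Slopes in [0, 1] make \<open>K\<close> nondecreasing and 1-Lipschitz, which is
    the source of the bound on \<open>\<phi> j\<close> that does not depend on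
    \<open>j\<close>.\<close>
  have Klip: "0 \<le> K y - K x \<and> K y - K x \<le> y - x" if "x \<le> y" for x y
  proof (cases "x < y")
    case True
    obtain z where "K y - K x = (y - x) * B z"
      using MVT2[OF True, of K B] K(2) by blast
    then show ?thesis
      using True K(3)[of z] K(4)[of z] by (auto intro: mult_left_le)
  qed (use that in simp)
  \<comment> \<open>The same scale sharpens the corners and measures how far the compensating terms
    are moved. Starting at 1 allows division by it.\<close>
  define s where "s j = real (Suc j)" for j
  have s1: "s j \<ge> 1" for j by (simp add: s_def)
  have s_top: "filterlim s at_top sequentially"
    unfolding s_def by (rule filterlim_compose[OF filterlim_real_sequentially filterlim_Suc])
  (* The last two terms move away to infinity; they make the ramp compactly supported. *)
  define Q where "Q g j x = g (s j * (x - a)) - g (s j * (x - b))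
      - g (s j * (x - a - s j)) + g (s j * (x - b - s j))" for g :: "real \<Rightarrow> real" and j x
  \<comment> \<open>The division cancels the chain rule factor, so \<open>Q K\<close> and
    \<open>Q B\<close> give the function and its derivative by one formula.\<close>
  define \<phi> where "\<phi> j x = Q K j x / s j" for j x
  have D: "(\<phi> j has_real_derivative Q B j x) (at x)" for j x
  proof -
    have "((\<lambda>x. K (s j * (x - d))) has_real_derivative B (s j * (x - d)) * s j) (at x)" for d
      by (rule DERIV_chain2[OF K(2)]) (auto intro!: derivative_eq_intros)
    note this[of a] this[of b] this[of "a + s j"] this[of "b + s j"]
    then have "(Q K j has_real_derivative Q B j x * s j) (at x)"
      unfolding Q_def by (auto intro!: derivative_eq_intros simp: algebra_simps)
    from DERIV_cdivide[OF this, of "s j"] show ?thesis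
      using s1[of j] by (simp add: \<phi>_def[abs_def])
  qed
  have deriv: "deriv (\<phi> j) = Q B j" for j
    using D by (auto intro: DERIV_imp_deriv)
  have test: "test_function (\<phi> j)" for j
    unfolding test_function_iff_smooth
  proof
    have eq: "\<phi> j = (\<lambda>x. ((1 / s j * K (s j * x + (- s j * a)) + (- 1 / s j) * K (s j * x + (- s j * b)))
        + (- 1 / s j) * K (s j * x + (- s j * (a + s j)))) + 1 / s j * K (s j * x + (- s j * (b + s j))))"
      by (rule ext) (simp add: \<phi>_def Q_def diff_divide_distrib add_divide_distrib algebra_simps)
    show "smooth (\<phi> j)"
      unfolding eq by (rule smooth_add smooth_affine[OF K(1)])+
    have "\<phi> j x = 0" if "x \<le> a" for x
    proof -
      have "s j * (x - d) \<le> 0" if "d \<ge> a" for d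
        using \<open>x \<le> a\<close> that s1[of j] by (intro mult_nonneg_nonpos) auto
      note this[of a] this[of b] this[of "a + s j"] this[of "b + s j"]
      then show ?thesis
        using \<open>a \<le> b\<close> s1[of j] by (simp add: \<phi>_def Q_def K diff_diff_add)
    qed
    \<comment> \<open>Here all four arguments exceed 1, where \<open>K\<close> is affine; the signs
      are chosen so that the linear parts and the four copies of \<open>c\<close> cancel.\<close>
    moreover have "\<phi> j x = 0" if "x \<ge> b + s j + 1" for x
    proof -
      have "s j * (x - d) \<ge> 1" if "d \<le> b + s j" for d
        using \<open>x \<ge> b + s j + 1\<close> that s1[of j] mult_mono[of 1 "s j" 1 "x - d"] by simp
      note this[of a] this[of b] this[of "a + s j"] this[of "b + s j"]
      then show ?thesis
        using \<open>a \<le> b\<close> s1[of j] by (simp add: \<phi>_def Q_def K diff_diff_add, simp add: algebra_simps)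
    qed
    ultimately have "{x. \<phi> j x \<noteq> 0} \<subseteq> {a .. b + s j + 1}"
      by (force simp: not_le[symmetric] intro: ccontr)
    then show "compact (closure {x. \<phi> j x \<noteq> 0})"
      by (meson bounded_subset compact_closure compact_Icc compact_imp_bounded)
  qed
  have \<phi>m[measurable]: "\<phi> j \<in> borel_measurable borel" for j
    using test by (simp add: test_function_iff_smooth smooth_borel_measurable)
  have Bm[measurable]: "Q B j \<in> borel_measurable borel" for j
    unfolding deriv[symmetric]
    using test by (simp add: test_function_iff_smooth smooth_borel_measurable smooth_deriv)
  have bound: "\<bar>\<phi> j x\<bar> \<le> 2 * (b - a)" for j x
  proof -
    have "s j * (x - b) \<le> s j * (x - a)" "s j * (x - b - s j) \<le> s j * (x - a - s j)"
      using s1[of j] \<open>a \<le> b\<close> by (auto intro!: mult_left_mono)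
    note * = this[THEN Klip]
    have "s j * (x - a) - s j * (x - b) = (b - a) * s j"
      "s j * (x - a - s j) - s j * (x - b - s j) = (b - a) * s j"
      by (simp_all add: algebra_simps)
    with * have "\<bar>Q K j x\<bar> \<le> 2 * ((b - a) * s j)"
      unfolding Q_def by linarith
    then show ?thesis
      using s1[of j] by (simp add: \<phi>_def field_simps)
  qed
  have boundB: "\<bar>Q B j x\<bar> \<le> 4" for j x
    unfolding Q_def
    using K(3,4)[of "s j * (x - a)"] K(3,4)[of "s j * (x - b)"]
      K(3,4)[of "s j * (x - a - s j)"] K(3,4)[of "s j * (x - b - s j)"] by linarith
  have ev1: "\<forall>\<^sub>F j in sequentially. s j * y \<ge> 1" if "y > 0" for y
  proof -
    have "\<forall>\<^sub>F j in sequentially. s j \<ge> 1 / y"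
      using s_top by (simp add: filterlim_at_top)
    then show ?thesis
      by eventually_elim (use that in \<open>simp add: field_simps\<close>)
  qed
  \<comment> \<open>At a fixed point the moving terms are eventually on the branch where
    \<open>K\<close> and \<open>B\<close> are 0. Pointwise disappearance suffices for dominated
    convergence.\<close>
  have ev2: "\<forall>\<^sub>F j in sequentially. s j * (y - s j) \<le> 0" for y
  proof -
    have "\<forall>\<^sub>F j in sequentially. s j \<ge> y"
      using s_top by (simp add: filterlim_at_top)
    then show ?thesis
      by eventually_elim (rule mult_nonneg_nonpos, use s1 in \<open>auto intro: order_trans[OF zero_le_one]\<close>)
  qed
  \<comment> \<open>At \<open>y = 0\<close> the value is \<open>B 0 = 0\<close>, which is why the
    limiting interval excludes \<open>a\<close> and includes \<open>b\<close>.\<close>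
  have limB: "(\<lambda>j. B (s j * y)) \<longlonglongrightarrow> (if y > 0 then 1 else 0)" for y
  proof (cases "y > 0")
    case True
    show ?thesis
      by (rule tendsto_eventually) (use ev1[OF True] in \<open>eventually_elim; use True in \<open>simp add: K\<close>\<close>)
  next
    case False
    then have "s j * y \<le> 0" for j using s1[of j] by (simp add: mult_nonneg_nonpos)
    then show ?thesis using False by (simp add: K)
  qed
  have limK: "(\<lambda>j. K (s j * y) / s j) \<longlonglongrightarrow> max 0 y" for y
  proof (cases "y > 0")
    case True
    have "(\<lambda>j. y - c / s j) \<longlonglongrightarrow> y - 0"
      by (intro tendsto_diff tendsto_const real_tendsto_divide_at_top[OF tendsto_const s_top])
    moreover have "\<forall>\<^sub>F j in sequentially. y - c / s j = K (s j * y) / s j"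
      using ev1[OF True] by eventually_elim (simp add: K diff_divide_distrib s_def)
    ultimately show ?thesis
      using True Lim_transform_eventually by fastforce
  next
    case False
    then have "s j * y \<le> 0" for j using s1[of j] by (simp add: mult_nonneg_nonpos)
    then show ?thesis using False by (simp add: K max_def)
  qed
  have far: "(\<lambda>j. B (s j * (y - s j))) \<longlonglongrightarrow> 0" "(\<lambda>j. K (s j * (y - s j)) / s j) \<longlonglongrightarrow> 0" for y
    by (rule tendsto_eventually, use ev2[of y] in \<open>eventually_elim; simp add: K\<close>)+
  have lim1: "(\<lambda>j. Q B j x) \<longlonglongrightarrow> indicator {a<..b} x" for x
  proof -
    have "(\<lambda>j. Q B j x) \<longlonglongrightarrow> (if x - a > 0 then 1 else 0) - (if x - b > 0 then 1 else 0) - 0 + 0"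
      unfolding Q_def by (intro tendsto_add tendsto_diff limB far)
    also have "(if x - a > 0 then 1 else 0) - (if x - b > 0 then 1 else 0) - 0 + (0::real) = indicator {a<..b} x"
      using \<open>a \<le> b\<close> by (auto simp: indicator_def)
    finally show ?thesis .
  qed
  have lim2: "(\<lambda>j. \<phi> j x) \<longlonglongrightarrow> max 0 (x - a) - max 0 (x - b)" for x
  proof -
    have "(\<lambda>j. \<phi> j x) \<longlonglongrightarrow> max 0 (x - a) - max 0 (x - b) - 0 + 0"
      unfolding \<phi>_def Q_def diff_divide_distrib add_divide_distrib
      by (intro tendsto_add tendsto_diff limK far)
    then show ?thesis by simp
  qed
  have "(\<lambda>j. expectation (\<lambda>\<omega>. Q B j (V \<omega>))) \<longlonglongrightarrow> expectation (\<lambda>\<omega>. indicator {a<..b} (V \<omega>))"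
    by (rule integral_dominated_convergence[where w = "\<lambda>_. 4"]) (auto simp: lim1 boundB)
  moreover have "(\<lambda>j. expectation (\<lambda>\<omega>. \<rho> (V \<omega>) * \<phi> j (V \<omega>))) \<longlonglongrightarrow>
      expectation (\<lambda>\<omega>. \<rho> (V \<omega>) * (max 0 (V \<omega> - a) - max 0 (V \<omega> - b)))"
  proof (rule integral_dominated_convergence[where w = "\<lambda>\<omega>. \<bar>\<rho> (V \<omega>)\<bar> * (2 * (b - a))"])
    show "integrable M (\<lambda>\<omega>. \<bar>\<rho> (V \<omega>)\<bar> * (2 * (b - a)))"
      using \<rho>i by (intro integrable_mult_left) auto
    show "AE \<omega> in M. norm (\<rho> (V \<omega>) * \<phi> j (V \<omega>)) \<le> \<bar>\<rho> (V \<omega>)\<bar> * (2 * (b - a))" for j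
      using bound by (auto simp: abs_mult intro!: mult_left_mono)
  qed (auto intro!: tendsto_mult lim2)
  moreover have "expectation (\<lambda>\<omega>. \<rho> (V \<omega>) * \<phi> j (V \<omega>)) = - expectation (\<lambda>\<omega>. Q B j (V \<omega>))" for j
    using \<rho> test[of j] by (simp add: is_score_def deriv)
  ultimately have "expectation (\<lambda>\<omega>. \<rho> (V \<omega>) * (max 0 (V \<omega> - a) - max 0 (V \<omega> - b)))
      = - expectation (\<lambda>\<omega>. indicator {a<..b} (V \<omega>))"
    by (auto dest: tendsto_minus intro: LIMSEQ_unique)
  also have "expectation (\<lambda>\<omega>. indicator {a<..b} (V \<omega>)) = expectation (indicator {\<omega>\<in>space M. a < V \<omega> \<and> V \<omega> \<le> b})"
    by (rule Bochner_Integration.integral_cong) (auto simp: indicator_def)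
  finally show ?thesis
    by simp
qed

section \<open>The tail of the score as a density\<close>

lemma (in prob_space) expectation_ramp_limit:
  fixes \<epsilon> :: "nat \<Rightarrow> real"
  assumes V[measurable]: "random_variable borel V"
    and [measurable]: "g \<in> borel_measurable borel" and gi: "integrable M (\<lambda>\<omega>. g (V \<omega>))"
    and pos: "\<And>j. \<epsilon> j > 0" and lim: "\<epsilon> \<longlonglongrightarrow> 0"
  shows "(\<lambda>j. expectation (\<lambda>\<omega>. g (V \<omega>) * (max 0 (V \<omega> - t) - max 0 (V \<omega> - (t + \<epsilon> j)))) / \<epsilon> j)
     \<longlonglongrightarrow> expectation (\<lambda>\<omega>. g (V \<omega>) * indicator {t<..} (V \<omega>))"
proof -
  let ?c = "\<lambda>j x. (max 0 (x - t) - max 0 (x - (t + \<epsilon> j))) / \<epsilon> j"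
  have b: "\<bar>?c j x\<bar> \<le> 1" for j x
    using pos[of j] by (auto simp: max_def)
  have l: "(\<lambda>j. ?c j x) \<longlonglongrightarrow> indicator {t<..} x" for x
  proof (cases "x > t")
    case True
    have "\<forall>\<^sub>F j in sequentially. \<epsilon> j < x - t"
      using order_tendstoD(2)[OF lim, of "x - t"] True by simp
    then have "\<forall>\<^sub>F j in sequentially. ?c j x = 1"
      by eventually_elim (use True pos in \<open>auto simp: max_def less_imp_neq[symmetric]\<close>)
    then show ?thesis using True by (auto intro: tendsto_eventually)
  next
    case False
    then have c0: "?c j x = 0" for j
      using pos[of j] by (auto simp: max_def)
    show ?thesis unfolding c0 using False by simp
  qed
  have "(\<lambda>j. expectation (\<lambda>\<omega>. g (V \<omega>) * ?c j (V \<omega>))) \<longlonglongrightarrow> expectation (\<lambda>\<omega>. g (V \<omega>) * indicator {t<..} (V \<omega>))"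
  proof (rule integral_dominated_convergence[where w = "\<lambda>\<omega>. \<bar>g (V \<omega>)\<bar>"])
    show "AE \<omega> in M. norm (g (V \<omega>) * ?c j (V \<omega>)) \<le> \<bar>g (V \<omega>)\<bar>" for j
      using b unfolding real_norm_def abs_mult by (intro AE_I2 mult_left_le) auto
    show "AE \<omega> in M. (\<lambda>j. g (V \<omega>) * ?c j (V \<omega>)) \<longlonglongrightarrow> g (V \<omega>) * indicator {t<..} (V \<omega>)"
      by (intro AE_I2 tendsto_mult tendsto_const l)
    show "integrable M (\<lambda>\<omega>. \<bar>g (V \<omega>)\<bar>)"
      using gi by (rule integrable_abs)
  qed measurable
  then show ?thesis
    by (simp add: times_divide_eq_right)
qed

text \<open>Formally the score is f'/f for the density f, so \<open>E[\<rho>(V); V > t]\<close> is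
  the integral of f' beyond \<open>t\<close>, that is -f(t). The definition takes this as the value
  of the density without assuming any regularity of it.\<close>

definition (in prob_space) score_tail :: "('a \<Rightarrow> real) \<Rightarrow> (real \<Rightarrow> real) \<Rightarrow> real \<Rightarrow> real" where
  "score_tail V \<rho> t = - expectation (\<lambda>\<omega>. \<rho> (V \<omega>) * indicator {t<..} (V \<omega>))"

text \<open>By \<open>score_ramp\<close> the tail is a limit of probabilities of the intervals from
  \<open>t\<close> to \<open>t + 1/(j+1)\<close> divided by their lengths: a right derivative of the
  distribution function.\<close>

lemma (in prob_space) score_tail_nonneg:
  assumes V[measurable]: "random_variable borel V" and \<rho>: "is_score M V \<rho>"
  shows "score_tail V \<rho> t \<ge> 0"
proof -
  have [measurable]: "\<rho> \<in> borel_measurable borel" and \<rho>i: "integrable M (\<lambda>\<omega>. \<rho> (V \<omega>))"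
    using \<rho> by (auto simp: is_score_def)
  let ?E = "\<lambda>j. expectation (\<lambda>\<omega>. \<rho> (V \<omega>) * (max 0 (V \<omega> - t) - max 0 (V \<omega> - (t + inverse (real (Suc j))))))"
  have "(\<lambda>j. ?E j / inverse (real (Suc j)))
     \<longlonglongrightarrow> expectation (\<lambda>\<omega>. \<rho> (V \<omega>) * indicator {t<..} (V \<omega>))"
    using \<rho>i by (intro expectation_ramp_limit LIMSEQ_inverse_real_of_nat) auto
  moreover have "?E j / inverse (real (Suc j)) \<le> 0" for j
  proof -
    have "0 \<le> - ?E j"
      by (subst score_ramp[OF V \<rho>, symmetric]) simp_all
    then show ?thesis
      by (intro divide_nonpos_pos) auto
  qed
  ultimately show ?thesis
    unfolding score_tail_def by (simp add: LIMSEQ_le_const2)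
qed

lemma integral_indicator_tail:
  fixes a b v :: real
  assumes "a \<le> b"
  shows "(\<integral>t. indicator {a<..b} t * indicator {t<..} v \<partial>lborel) = max 0 (v - a) - max 0 (v - b)"
    "integrable lborel (\<lambda>t. indicator {a<..b} t * indicator {t<..} v :: real)"
proof -
  have "indicator {a<..b} t * indicator {t<..} v = (indicator (if v \<le> b then {a<..<v} else {a<..b}) t :: real)" for t
    by (auto simp: indicator_def)
  moreover have "integrable lborel (indicator (if v \<le> b then {a<..<v} else {a<..b}) :: real \<Rightarrow> real)"
    by (intro integrable_real_indicator emeasure_bounded_finite) auto
  ultimately show "(\<integral>t. indicator {a<..b} t * indicator {t<..} v \<partial>lborel) = max 0 (v - a) - max 0 (v - b)"
    "integrable lborel (\<lambda>t. indicator {a<..b} t * indicator {t<..} v :: real)"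
    using assms by (auto simp: measure_def max_def)
qed

text \<open>Fubini: the tail indicators integrate over \<open>t\<close> in the interval to the ramp
  between \<open>a\<close> and \<open>b\<close>, and \<open>score_ramp\<close> evaluates the
  expectation of the score against that ramp. The ramp is at most \<open>b - a\<close>, so an
  integrable score is enough.\<close>

lemma (in prob_space) score_tail_integral:
  assumes V[measurable]: "random_variable borel V" and \<rho>: "is_score M V \<rho>" and "a \<le> b"
  shows "integrable lborel (\<lambda>t. indicator {a<..b} t * score_tail V \<rho> t)"
    "(\<integral>t. indicator {a<..b} t * score_tail V \<rho> t \<partial>lborel) = prob {\<omega>\<in>space M. a < V \<omega> \<and> V \<omega> \<le> b}"
proof -
  have [measurable]: "\<rho> \<in> borel_measurable borel" and \<rho>i: "integrable M (\<lambda>\<omega>. \<rho> (V \<omega>))"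
    using \<rho> by (auto simp: is_score_def)
  interpret P: pair_sigma_finite M lborel ..
  let ?F = "\<lambda>\<omega> t. \<rho> (V \<omega>) * (indicator {a<..b} t * indicator {t<..} (V \<omega>))"
  have mF[measurable]: "case_prod ?F \<in> borel_measurable (M \<Otimes>\<^sub>M lborel)"
    unfolding indicator_def greaterThan_iff by measurable
  have n: "(\<integral>t. norm (?F \<omega> t) \<partial>lborel) = \<bar>\<rho> (V \<omega>)\<bar> * (max 0 (V \<omega> - a) - max 0 (V \<omega> - b))" for \<omega>
    using integral_indicator_tail[OF \<open>a \<le> b\<close>] by (simp add: abs_mult)
  have F: "integrable (M \<Otimes>\<^sub>M lborel) (case_prod ?F)"
  proof (rule P.Fubini_integrable[OF mF])
    show "integrable M (\<lambda>\<omega>. \<integral>t. norm (case_prod ?F (\<omega>, t)) \<partial>lborel)"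
      unfolding prod.case n
    proof (rule Bochner_Integration.integrable_bound)
      show "integrable M (\<lambda>\<omega>. (b - a) * \<rho> (V \<omega>))"
        using \<rho>i by (rule integrable_mult_right)
      have "\<bar>max 0 (V \<omega> - a) - max 0 (V \<omega> - b)\<bar> \<le> b - a" for \<omega>
        using \<open>a \<le> b\<close> by (auto simp: max_def)
      from mult_right_mono[OF this abs_ge_zero[of "\<rho> (V _)"]]
      show "AE \<omega> in M. norm (\<bar>\<rho> (V \<omega>)\<bar> * (max 0 (V \<omega> - a) - max 0 (V \<omega> - b))) \<le> norm ((b - a) * \<rho> (V \<omega>))"
        using \<open>a \<le> b\<close> by (intro AE_I2) (simp add: abs_mult mult.commute)
    qed measurable
    show "AE \<omega> in M. integrable lborel (\<lambda>t. case_prod ?F (\<omega>, t))"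
      using integral_indicator_tail(2)[OF \<open>a \<le> b\<close>] by (auto intro!: integrable_mult_right)
  qed
  have tail: "expectation (\<lambda>\<omega>. ?F \<omega> t) = - (indicator {a<..b} t * score_tail V \<rho> t)" for t
    unfolding score_tail_def integral_mult_right_zero[symmetric]
    by (simp add: mult_ac integral_mult_right_zero[symmetric] del: integral_mult_right_zero integral_mult_left_zero)
  have "integrable lborel (\<lambda>t. - (indicator {a<..b} t * score_tail V \<rho> t))"
    using P.integrable_snd[OF F] by (simp only: tail)
  then show "integrable lborel (\<lambda>t. indicator {a<..b} t * score_tail V \<rho> t)"
    by simp
  have "(\<integral>t. - (indicator {a<..b} t * score_tail V \<rho> t) \<partial>lborel) = (\<integral>t. (\<integral>\<omega>. ?F \<omega> t \<partial>M) \<partial>lborel)"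
    by (simp only: tail)
  also have "\<dots> = (\<integral>\<omega>. (\<integral>t. ?F \<omega> t \<partial>lborel) \<partial>M)"
    by (rule P.Fubini_integral[OF F])
  also have "\<dots> = (\<integral>\<omega>. \<rho> (V \<omega>) * (max 0 (V \<omega> - a) - max 0 (V \<omega> - b)) \<partial>M)"
    using integral_indicator_tail[OF \<open>a \<le> b\<close>] by simp
  also have "\<dots> = - prob {\<omega>\<in>space M. a < V \<omega> \<and> V \<omega> \<le> b}"
    using score_ramp[OF V \<rho> \<open>a \<le> b\<close>] by simp
  finally show "(\<integral>t. indicator {a<..b} t * score_tail V \<rho> t \<partial>lborel) = prob {\<omega>\<in>space M. a < V \<omega> \<and> V \<omega> \<le> b}"
    by simp
qed

lemma (in prob_space) score_tail_measurable[measurable]: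
  assumes V[measurable]: "random_variable borel V" and \<rho>: "is_score M V \<rho>"
  shows "score_tail V \<rho> \<in> borel_measurable borel"
proof -
  have [measurable]: "\<rho> \<in> borel_measurable borel"
    using \<rho> by (auto simp: is_score_def)
  have "(\<lambda>(t, \<omega>). \<rho> (V \<omega>) * indicator {t<..} (V \<omega>)) \<in> borel_measurable (borel \<Otimes>\<^sub>M M)"
    unfolding indicator_def greaterThan_iff by measurable
  then show ?thesis
    unfolding score_tail_def[abs_def] by measurable
qed

text \<open>Both measures agree on half-open intervals, which generate the Borel sets and are closed
  under intersection. Nonnegativity of the tail matters, since the coercion to
  \<open>ennreal\<close> would replace negative values by 0.\<close>

lemma (in prob_space) distr_eq_density_score_tail:
  assumes V[measurable]: "random_variable borel V" and \<rho>: "is_score M V \<rho>"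
  shows "distr M borel V = density lborel (score_tail V \<rho>)"
proof (rule measure_eqI_generator_eq[where E = "range (\<lambda>(a, b). {a<..b::real})" and \<Omega> = UNIV
      and A = "\<lambda>i. {- real i<..real i}"])
  note [measurable] = score_tail_measurable[OF V \<rho>]
  show "Int_stable (range (\<lambda>(a, b). {a<..b::real}))"
    by (auto simp: Int_stable_def)
  show "(\<Union>i. {- real i<..real i}) = UNIV"
  proof -
    have "\<exists>i. - real i < x \<and> x \<le> real i" for x
      using reals_Archimedean2[of "\<bar>x\<bar>"] by (metis abs_less_iff less_imp_le minus_less_iff)
    then show ?thesis by auto
  qed
  show "emeasure (distr M borel V) {- real i<..real i} \<noteq> \<infinity>" for i
    by (simp add: emeasure_distr emeasure_eq_measure)
  fix X assume "X \<in> range (\<lambda>(a, b). {a<..b::real})"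
  then obtain a b where X: "X = {a<..b}" by auto
  show "emeasure (distr M borel V) X = emeasure (density lborel (score_tail V \<rho>)) X"
  proof (cases "a \<le> b")
    case True
    have "emeasure (distr M borel V) X = ennreal (prob {\<omega>\<in>space M. a < V \<omega> \<and> V \<omega> \<le> b})"
      unfolding X by (subst emeasure_distr) (auto simp: emeasure_eq_measure intro!: arg_cong[where f = prob])
    also have "\<dots> = (\<integral>\<^sup>+t. ennreal (indicator {a<..b} t * score_tail V \<rho> t) \<partial>lborel)"
      using score_tail_integral[OF V \<rho> True] score_tail_nonneg[OF V \<rho>]
      by (subst nn_integral_eq_integral) auto
    also have "\<dots> = emeasure (density lborel (score_tail V \<rho>)) X"
      unfolding X by (subst emeasure_density) (auto intro!: nn_integral_cong simp: indicator_def)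
    finally show ?thesis .
  qed (simp add: X)
qed (auto simp: borel_sigma_sets_Ioc)

section \<open>Integration by parts\<close>

text \<open>A derivative need not be continuous, but it is a pointwise limit of difference quotients
  of a continuous function.\<close>

lemma borel_measurable_DERIV:
  fixes \<phi> :: "real \<Rightarrow> real"
  assumes D: "\<And>x. (\<phi> has_real_derivative \<phi>' x) (at x)"
  shows "\<phi>' \<in> borel_measurable borel"
proof (rule borel_measurable_LIMSEQ_real)
  have [measurable]: "\<phi> \<in> borel_measurable borel"
    by (intro borel_measurable_continuous_onI continuous_at_imp_continuous_on ballI DERIV_isCont[OF D])
  show "(\<lambda>x. (\<phi> (x + inverse (real (Suc n))) - \<phi> x) / inverse (real (Suc n))) \<in> borel_measurable borel" for n
    by measurable
  show "(\<lambda>n. (\<phi> (x + inverse (real (Suc n))) - \<phi> x) / inverse (real (Suc n))) \<longlonglongrightarrow> \<phi>' x" for x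
    using D[of x] unfolding DERIV_def tendsto_at_iff_sequentially
    by (auto simp: o_def dest!: spec[of _ "\<lambda>n. inverse (real (Suc n))"] intro: LIMSEQ_inverse_real_of_nat)
qed

text \<open>A nonzero limit would keep \<open>\<bar>w\<bar>\<close> above
  \<open>\<bar>L\<bar> / 2\<close> on a half-line, which has infinite measure. This removes boundary
  terms at infinity when only their convergence and integrability are known.\<close>

lemma integrable_tendsto_at_top_imp_zero:
  fixes w :: "real \<Rightarrow> real"
  assumes w: "integrable lborel w" and lim: "(w \<longlongrightarrow> L) at_top"
  shows "L = 0"
proof (rule ccontr)
  assume "L \<noteq> 0"
  have "\<forall>\<^sub>F x in at_top. dist (w x) L < \<bar>L\<bar> / 2"
    using lim \<open>L \<noteq> 0\<close> by (intro tendstoD) auto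
  then obtain N where N: "\<And>x. x \<ge> N \<Longrightarrow> dist (w x) L < \<bar>L\<bar> / 2"
    by (auto simp: eventually_at_top_linorder)
  have "\<bar>L\<bar> / 2 * real n \<le> (\<integral>x. \<bar>w x\<bar> \<partial>lborel)" for n :: nat
  proof -
    have "(\<integral>x. \<bar>L\<bar> / 2 * indicator {N..N + real n} x \<partial>lborel) \<le> (\<integral>x. \<bar>w x\<bar> \<partial>lborel)"
    proof (rule integral_mono)
      show "integrable lborel (\<lambda>x. \<bar>L\<bar> / 2 * indicator {N..N + real n} x)"
        by (intro integrable_mult_right integrable_real_indicator emeasure_bounded_finite) auto
      show "\<bar>L\<bar> / 2 * indicator {N..N + real n} x \<le> \<bar>w x\<bar>" for x
        using N[of x] by (auto simp: indicator_def dist_real_def abs_if split: if_splits)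
    qed (use w in simp)
    then show ?thesis by (simp add: measure_def)
  qed
  moreover obtain n :: nat where "(\<integral>x. \<bar>w x\<bar> \<partial>lborel) / (\<bar>L\<bar> / 2) < real n"
    using reals_Archimedean2 by blast
  ultimately show False
    using \<open>L \<noteq> 0\<close> by (auto simp: field_simps not_le[symmetric])
qed

lemma integrable_mult_indicator_continuous:
  fixes \<phi> :: "real \<Rightarrow> real"
  assumes [measurable]: "V \<in> borel_measurable M" and r: "integrable M r" and \<phi>: "continuous_on UNIV \<phi>"
  shows "integrable M (\<lambda>\<omega>. r \<omega> * (indicator {x<..y} (V \<omega>) * \<phi> (V \<omega>)))"
proof -
  note [measurable] = borel_measurable_integrable[OF r] borel_measurable_continuous_onI[OF \<phi>]
  have "bounded (\<phi> ` {x..y})"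
    by (intro compact_imp_bounded compact_continuous_image continuous_on_subset[OF \<phi>]) auto
  then obtain B where B: "\<And>z. z \<in> {x..y} \<Longrightarrow> \<bar>\<phi> z\<bar> \<le> B"
    by (force simp: bounded_iff)
  show ?thesis
  proof (rule Bochner_Integration.integrable_bound[OF integrable_mult_right[OF r, of "max B 0"]])
    show "AE \<omega> in M. norm (r \<omega> * (indicator {x<..y} (V \<omega>) * \<phi> (V \<omega>))) \<le> norm (max B 0 * r \<omega>)"
    proof (rule AE_I2)
      fix \<omega>
      have "\<bar>indicator {x<..y} (V \<omega>) * \<phi> (V \<omega>)\<bar> \<le> max B 0"
        using B[of "V \<omega>"] by (auto simp: indicator_def)
      from mult_right_mono[OF this, of "\<bar>r \<omega>\<bar>"]
      show "norm (r \<omega> * (indicator {x<..y} (V \<omega>) * \<phi> (V \<omega>))) \<le> norm (max B 0 * r \<omega>)"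
        by (simp add: abs_mult mult.commute)
    qed
  qed measurable
qed

text \<open>This is Stieltjes integration by parts: \<open>g\<close> is the distribution function of
  \<open>V\<close> weighted by \<open>r\<close>, and \<open>J\<close> is the integral of
  \<open>\<phi>\<close> against \<open>dg\<close>. A nonnegative weight makes \<open>g\<close>
  monotone, which the second mean value theorem requires.\<close>

lemma has_integral_by_parts_nonneg_weight:
  fixes V r :: "'a \<Rightarrow> real" and \<phi> :: "real \<Rightarrow> real"
  assumes V[measurable]: "V \<in> borel_measurable M" and r: "integrable M r" and r0: "\<And>\<omega>. r \<omega> \<ge> 0"
    and D: "\<And>x. (\<phi> has_real_derivative \<phi>' x) (at x)" and "a \<le> b"
  defines "g \<equiv> (\<lambda>x. \<integral>\<omega>. r \<omega> * indicator {..x} (V \<omega>) \<partial>M)"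
    and "J \<equiv> (\<lambda>x y. \<integral>\<omega>. r \<omega> * (indicator {x<..y} (V \<omega>) * \<phi> (V \<omega>)) \<partial>M)"
  shows "((\<lambda>x. \<phi>' x * g x) has_integral (\<phi> b * g b - \<phi> a * g a - J a b)) {a..b}"
proof -
  have cont: "continuous_on A \<phi>" for A
    by (intro continuous_at_imp_continuous_on ballI DERIV_isCont[OF D])
  note [measurable] = borel_measurable_integrable[OF r] borel_measurable_continuous_onI[OF cont]
  have Ji: "integrable M (\<lambda>\<omega>. r \<omega> * (indicator {x<..y} (V \<omega>) * \<psi> (V \<omega>)))"
    if "continuous_on UNIV \<psi>" for x y and \<psi> :: "real \<Rightarrow> real"
    by (rule integrable_mult_indicator_continuous[OF V r that])
  have gi: "integrable M (\<lambda>\<omega>. r \<omega> * indicator {..x} (V \<omega>))" for x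
    by (rule Bochner_Integration.integrable_bound[OF r]) (auto simp: indicator_def)
  have gi': "integrable M (\<lambda>\<omega>. r \<omega> * indicator {x<..y} (V \<omega>))" for x y
    using Ji[of "\<lambda>_. 1"] by simp
  have gdiff: "g y - g x = (\<integral>\<omega>. r \<omega> * indicator {x<..y} (V \<omega>) \<partial>M)" if "x \<le> y" for x y
    unfolding g_def using that
    by (subst Bochner_Integration.integral_diff[OF gi gi, symmetric])
      (auto intro!: Bochner_Integration.integral_cong simp: indicator_def)
  have gmono: "g x \<le> g y" if "x \<le> y" for x y
  proof -
    have "0 \<le> g y - g x"
      unfolding gdiff[OF that] by (intro integral_nonneg_AE AE_I2) (simp add: r0)
    then show ?thesis by simp
  qed
  \<comment> \<open>Every derivative is integrable in the Henstock-Kurzweil sense, with no condition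
    on its size or continuity.\<close>
  have ftc: "(\<phi>' has_integral (\<phi> y - \<phi> x)) {x..y}" if "x \<le> y" for x y
    using D that by (intro fundamental_theorem_of_calculus)
      (auto simp: has_real_derivative_iff_has_vector_derivative[symmetric] intro: has_field_derivative_at_within)
  \<comment> \<open>The second mean value theorem also supplies the integrability of the product of
    \<open>\<phi>'\<close> with the monotone \<open>g\<close>.\<close>
  have mvt: "\<exists>c\<in>{x..y}. ((\<lambda>z. \<phi>' z * g z) has_integral (g x * (\<phi> c - \<phi> x) + g y * (\<phi> y - \<phi> c))) {x..y}"
    if "x \<le> y" for x y
  proof -
    have "\<phi>' integrable_on {x..y}" using ftc[OF that] by blast
    then obtain c where c: "c \<in> {x..y}"
      "((\<lambda>z. g z * \<phi>' z) has_integral (g x * integral {x..c} \<phi>' + g y * integral {c..y} \<phi>')) {x..y}"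
      by (rule second_mean_value_theorem_full[of \<phi>' x y g]) (use \<open>x \<le> y\<close> gmono in auto)
    moreover have "integral {x..c} \<phi>' = \<phi> c - \<phi> x" "integral {c..y} \<phi>' = \<phi> y - \<phi> c"
      using c(1) by (auto intro!: integral_unique ftc)
    ultimately show ?thesis by (auto simp: mult.commute)
  qed
  have int: "(\<lambda>z. \<phi>' z * g z) integrable_on {x..y}" for x y
    using mvt[of x y] by (cases "x \<le> y") auto
  (* The defect E is additive over adjacent intervals. By the second mean value theorem it is at
     most the oscillation of \<phi> times the increment of g, so it vanishes by subdivision. *)
  define E where "E x y = integral {x..y} (\<lambda>z. \<phi>' z * g z) - (\<phi> y * g y - \<phi> x * g x - J x y)" for x y
  have Eadd: "E x z = E x y + E y z" if "x \<le> y" "y \<le> z" for x y z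
  proof -
    have "J x z = J x y + J y z"
      unfolding J_def using that
      by (subst Bochner_Integration.integral_add[OF Ji[OF cont] Ji[OF cont], symmetric])
        (auto intro!: Bochner_Integration.integral_cong simp: indicator_def)
    moreover have "integral {x..z} (\<lambda>z. \<phi>' z * g z) = integral {x..y} (\<lambda>z. \<phi>' z * g z) + integral {y..z} (\<lambda>z. \<phi>' z * g z)"
      using Henstock_Kurzweil_Integration.integral_combine[OF that int] by simp
    ultimately show ?thesis by (simp add: E_def)
  qed
  \<comment> \<open>Bolzano's principle: the bound passes to unions of adjacent intervals, since
    \<open>E\<close> is additive and the increments of \<open>g\<close> add up, and it holds on
    short intervals around each point. Continuity of \<open>\<phi>\<close> at single points is then
    enough.\<close>
  have "\<bar>E a b\<bar> \<le> \<epsilon> * (g b - g a)" if "\<epsilon> > 0" for \<epsilon>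
    using \<open>a \<le> b\<close>
  proof (induction rule: Bolzano)
    case (trans x y z)
    then show ?case
      using Eadd[of x y z] by (simp add: algebra_simps)
  next
    case (local x0)
    \<comment> \<open>Two points of a short interval are compared through \<open>x0\<close>, each
      within half of \<open>\<epsilon>\<close>.\<close>
    obtain d where "d > 0" and d: "\<And>z. \<bar>z - x0\<bar> < d \<Longrightarrow> \<bar>\<phi> z - \<phi> x0\<bar> < \<epsilon> / 2"
      using DERIV_isCont[OF D, of x0] \<open>\<epsilon> > 0\<close>
      unfolding continuous_at_eps_delta dist_real_def by (metis half_gt_zero)
    have "\<bar>E x y\<bar> \<le> \<epsilon> * (g y - g x)" if xy: "x \<le> x0" "x0 \<le> y" "y - x < d" for x y
    proof -
      have "x \<le> y" using xy by simp
      obtain c where c: "c \<in> {x..y}"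
        "integral {x..y} (\<lambda>z. \<phi>' z * g z) = g x * (\<phi> c - \<phi> x) + g y * (\<phi> y - \<phi> c)"
        using mvt[OF \<open>x \<le> y\<close>] integral_unique by blast
      have near: "\<bar>\<phi> z - \<phi> c\<bar> \<le> \<epsilon>" if "z \<in> {x..y}" for z
      proof -
        have "\<bar>z - x0\<bar> < d" "\<bar>c - x0\<bar> < d"
          using that c(1) xy by auto
        from this[THEN d] show ?thesis by linarith
      qed
      \<comment> \<open>With the mean value expression inserted, the endpoint values of
        \<open>\<phi>\<close> cancel. What remains is the integral of
        \<open>\<phi> - \<phi> c\<close> against \<open>dg\<close>, where \<open>\<phi>\<close>
        stays within \<open>\<epsilon>\<close> of \<open>\<phi> c\<close>.\<close>
      have "E x y = J x y - \<phi> c * (g y - g x)"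
        unfolding E_def c(2) by (simp add: algebra_simps)
      also have "\<dots> = (\<integral>\<omega>. r \<omega> * (indicator {x<..y} (V \<omega>) * \<phi> (V \<omega>)) - \<phi> c * (r \<omega> * indicator {x<..y} (V \<omega>)) \<partial>M)"
        unfolding J_def gdiff[OF \<open>x \<le> y\<close>]
        by (subst Bochner_Integration.integral_diff[OF Ji[OF cont] integrable_mult_right[OF gi']]) simp
      also have "\<bar>\<dots>\<bar> \<le> (\<integral>\<omega>. \<epsilon> * (r \<omega> * indicator {x<..y} (V \<omega>)) \<partial>M)"
      proof (rule integral_abs_bound[THEN order_trans], rule integral_mono)
        show "integrable M (\<lambda>\<omega>. \<bar>r \<omega> * (indicator {x<..y} (V \<omega>) * \<phi> (V \<omega>)) - \<phi> c * (r \<omega> * indicator {x<..y} (V \<omega>))\<bar>)"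
          by (intro integrable_abs Bochner_Integration.integrable_diff Ji[OF cont] integrable_mult_right gi')
        show "integrable M (\<lambda>\<omega>. \<epsilon> * (r \<omega> * indicator {x<..y} (V \<omega>)))"
          by (intro integrable_mult_right gi')
        show "\<bar>r \<omega> * (indicator {x<..y} (V \<omega>) * \<phi> (V \<omega>)) - \<phi> c * (r \<omega> * indicator {x<..y} (V \<omega>))\<bar>
            \<le> \<epsilon> * (r \<omega> * indicator {x<..y} (V \<omega>))" for \<omega>
        proof (cases "V \<omega> \<in> {x<..y}")
          case True
          then have "r \<omega> * \<bar>\<phi> (V \<omega>) - \<phi> c\<bar> \<le> r \<omega> * \<epsilon>"
            using near[of "V \<omega>"] r0[of \<omega>] by (intro mult_left_mono) auto
          moreover have "r \<omega> * (indicator {x<..y} (V \<omega>) * \<phi> (V \<omega>)) - \<phi> c * (r \<omega> * indicator {x<..y} (V \<omega>))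
              = r \<omega> * (\<phi> (V \<omega>) - \<phi> c)"
            using True by (simp add: algebra_simps)
          ultimately show ?thesis
            using True r0[of \<omega>] by (simp add: abs_mult mult.commute)
        qed simp
      qed
      also have "\<dots> = \<epsilon> * (g y - g x)"
        unfolding gdiff[OF \<open>x \<le> y\<close>] by simp
      finally show ?thesis .
    qed
    then show ?case using \<open>d > 0\<close> by blast
  qed
  then have "\<bar>E a b\<bar> \<le> 0 + \<epsilon>" if "\<epsilon> > 0" for \<epsilon>
  proof -
    \<comment> \<open>The 1 in the denominator avoids division by 0 when \<open>g\<close> does not
      increase.\<close>
    have "\<bar>E a b\<bar> \<le> \<epsilon> / (g b - g a + 1) * (g b - g a)"
      using \<open>\<epsilon> > 0\<close> gmono[OF \<open>a \<le> b\<close>] by (intro \<open>\<And>\<epsilon>. 0 < \<epsilon> \<Longrightarrow> \<bar>E a b\<bar> \<le> \<epsilon> * (g b - g a)\<close>) auto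
    also have "\<dots> \<le> \<epsilon>"
      using \<open>\<epsilon> > 0\<close> gmono[OF \<open>a \<le> b\<close>] by (auto simp: field_simps)
    finally show ?thesis by simp
  qed
  then have "\<bar>E a b\<bar> \<le> 0" by (rule field_le_epsilon)
  then show ?thesis
    using integrable_integral[OF int[of a b]] by (simp add: E_def)
qed

text \<open>The weight is split into its positive and negative parts. Upper tails and lower
  distribution functions are complementary, so \<open>f\<close> differs from the difference of the
  two monotone functions by the constant integral of \<open>r\<close>, whose contribution is given
  by the fundamental theorem of calculus.\<close>

lemma has_integral_by_parts_weight:
  fixes V r :: "'a \<Rightarrow> real" and \<phi> :: "real \<Rightarrow> real"
  assumes V[measurable]: "V \<in> borel_measurable M" and r: "integrable M r"
    and D: "\<And>x. (\<phi> has_real_derivative \<phi>' x) (at x)" and "a \<le> b"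
  defines "f \<equiv> (\<lambda>x. - (\<integral>\<omega>. r \<omega> * indicator {x<..} (V \<omega>) \<partial>M))"
  shows "((\<lambda>x. \<phi>' x * f x) has_integral
    (\<phi> b * f b - \<phi> a * f a - (\<integral>\<omega>. r \<omega> * (indicator {a<..b} (V \<omega>) * \<phi> (V \<omega>)) \<partial>M))) {a..b}"
proof -
  note [measurable] = borel_measurable_integrable[OF r]
  define p where "p \<omega> = max 0 (r \<omega>)" for \<omega>
  define q where "q \<omega> = max 0 (- r \<omega>)" for \<omega>
  have p: "integrable M p" and q: "integrable M q"
    unfolding p_def q_def by (auto intro!: Bochner_Integration.integrable_bound[OF r])
  have r_eq: "r \<omega> = p \<omega> - q \<omega>" for \<omega> by (auto simp: p_def q_def)
  have gi: "integrable M (\<lambda>\<omega>. h \<omega> * indicator {..x} (V \<omega>))" "integrable M (\<lambda>\<omega>. h \<omega> * indicator {x<..} (V \<omega>))"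
    if h: "integrable M h" for h :: "'a \<Rightarrow> real" and x
    using borel_measurable_integrable[OF h]
    by (auto intro!: Bochner_Integration.integrable_bound[OF h] simp: indicator_def)
  let ?G = "\<lambda>h x. \<integral>\<omega>. h \<omega> * indicator {..x} (V \<omega>) \<partial>M"
  let ?J = "\<lambda>h. \<integral>\<omega>. h \<omega> * (indicator {a<..b} (V \<omega>) * \<phi> (V \<omega>)) \<partial>M"
  have f: "f x = ?G p x - ?G q x - (\<integral>\<omega>. r \<omega> \<partial>M)" for x
  proof -
    have "f x = (\<integral>\<omega>. r \<omega> * indicator {..x} (V \<omega>) \<partial>M) - (\<integral>\<omega>. r \<omega> \<partial>M)"
      unfolding f_def
      by (subst Bochner_Integration.integral_diff[OF gi(1)[OF r] r, symmetric])
        (auto simp: indicator_def not_le simp flip: integral_minus intro!: Bochner_Integration.integral_cong)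
    also have "(\<integral>\<omega>. r \<omega> * indicator {..x} (V \<omega>) \<partial>M) = ?G p x - ?G q x"
      by (subst Bochner_Integration.integral_diff[OF gi(1)[OF p] gi(1)[OF q], symmetric])
        (auto simp: r_eq left_diff_distrib)
    finally show ?thesis .
  qed
  have cont: "continuous_on UNIV \<phi>"
    by (intro continuous_at_imp_continuous_on ballI DERIV_isCont[OF D])
  have J: "?J r = ?J p - ?J q"
    by (subst Bochner_Integration.integral_diff[OF integrable_mult_indicator_continuous[OF V p cont]
        integrable_mult_indicator_continuous[OF V q cont], symmetric])
      (auto simp: r_eq left_diff_distrib)
  have ftc: "(\<phi>' has_integral (\<phi> b - \<phi> a)) {a..b}"
    using D \<open>a \<le> b\<close> by (intro fundamental_theorem_of_calculus)
      (auto simp: has_real_derivative_iff_has_vector_derivative[symmetric] intro: has_field_derivative_at_within)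
  have "((\<lambda>x. \<phi>' x * ?G p x - \<phi>' x * ?G q x - \<phi>' x * (\<integral>\<omega>. r \<omega> \<partial>M)) has_integral
    ((\<phi> b * ?G p b - \<phi> a * ?G p a - ?J p) - (\<phi> b * ?G q b - \<phi> a * ?G q a - ?J q)
      - (\<phi> b - \<phi> a) * (\<integral>\<omega>. r \<omega> \<partial>M))) {a..b}"
    by (intro has_integral_diff has_integral_mult_left has_integral_by_parts_nonneg_weight[OF V _ _ D \<open>a \<le> b\<close>] ftc p q)
      (auto simp: p_def q_def)
  then show ?thesis
    unfolding f J by (simp add: algebra_simps)
qed

text \<open>The tail \<open>f\<close> plays two roles: it is the weight function in the integration
  by parts with \<open>r = \<rho>(V)\<close>, and it is the density of \<open>V\<close>. No decay of
  \<open>\<phi>\<close> is assumed: the boundary term \<open>u x - u (- x)\<close> converges because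
  both expectations do, and its limit is 0 because \<open>u = \<phi> * f\<close> is
  integrable.\<close>

lemma (in prob_space) score_by_parts:
  assumes V[measurable]: "random_variable borel V" and \<rho>: "is_score M V \<rho>"
    and D: "\<And>x. (\<phi> has_real_derivative \<phi>' x) (at x)"
    and \<phi>i: "integrable M (\<lambda>\<omega>. \<phi> (V \<omega>))" and \<phi>'i: "integrable M (\<lambda>\<omega>. \<phi>' (V \<omega>))"
    and \<rho>\<phi>i: "integrable M (\<lambda>\<omega>. \<rho> (V \<omega>) * \<phi> (V \<omega>))"
  shows "expectation (\<lambda>\<omega>. \<rho> (V \<omega>) * \<phi> (V \<omega>)) = - expectation (\<lambda>\<omega>. \<phi>' (V \<omega>))"
proof -
  have [measurable]: "\<rho> \<in> borel_measurable borel" and \<rho>i: "integrable M (\<lambda>\<omega>. \<rho> (V \<omega>))"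
    using \<rho> by (auto simp: is_score_def)
  define f where "f = score_tail V \<rho>"
  have [measurable]: "f \<in> borel_measurable borel" and f0: "f x \<ge> 0" for x
    unfolding f_def using score_tail_measurable[OF V \<rho>] score_tail_nonneg[OF V \<rho>] by auto
  have [measurable]: "\<phi> \<in> borel_measurable borel" "\<phi>' \<in> borel_measurable borel"
    using borel_measurable_DERIV[OF D] by (auto intro!: borel_measurable_continuous_onI continuous_at_imp_continuous_on DERIV_isCont[OF D])
  have trans_int: "integrable lborel (\<lambda>x. h x * f x)" if "integrable M (\<lambda>\<omega>. h (V \<omega>))" "h \<in> borel_measurable borel" for h :: "real \<Rightarrow> real"
  proof -
    have "integrable (distr M borel V) h"
      using that by (simp add: integrable_distr_eq)
    then show ?thesis
      unfolding distr_eq_density_score_tail[OF V \<rho>] f_def[symmetric]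
      using that f0 by (subst (asm) integrable_density) (auto simp: mult.commute)
  qed
  have trans: "expectation (\<lambda>\<omega>. h (V \<omega>)) = (\<integral>x. h x * f x \<partial>lborel)" if "h \<in> borel_measurable borel" for h :: "real \<Rightarrow> real"
  proof -
    have "expectation (\<lambda>\<omega>. h (V \<omega>)) = integral\<^sup>L (distr M borel V) h"
      using that by (simp add: integral_distr)
    then show ?thesis
      unfolding distr_eq_density_score_tail[OF V \<rho>] f_def[symmetric]
      using that f0 by (subst (asm) integral_density) (auto simp: mult.commute)
  qed
  define u where "u x = \<phi> x * f x" for x
  have u: "integrable lborel u"
    unfolding u_def[abs_def] by (rule trans_int[OF \<phi>i]) simp
  \<comment> \<open>Although \<open>\<phi>'\<close> may fail to be locally Lebesgue integrable,
    \<open>\<phi>' * f\<close> is Lebesgue integrable because \<open>\<phi>'(V)\<close> has an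
    expectation. Its Lebesgue and Henstock-Kurzweil integrals over the interval therefore agree by
    uniqueness.\<close>
  have parts: "u b - u a = expectation (\<lambda>\<omega>. indicator {a..b} (V \<omega>) * \<phi>' (V \<omega>))
      + expectation (\<lambda>\<omega>. indicator {a<..b} (V \<omega>) * (\<rho> (V \<omega>) * \<phi> (V \<omega>)))" if "a \<le> b" for a b
  proof -
    have i1: "integrable lborel (\<lambda>x. indicator {a..b} x * (\<phi>' x * f x))"
      using integrable_mult_indicator[OF _ trans_int[OF \<phi>'i], of "{a..b}"] by simp
    define I where "I = (\<integral>x. indicator {a..b} x * (\<phi>' x * f x) \<partial>lborel)"
    have "((\<lambda>x. indicator {a..b} x * (\<phi>' x * f x)) has_integral I) UNIV"
      unfolding I_def by (rule has_integral_integral_lborel[OF i1])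
    also have "(\<lambda>x. indicator {a..b} x * (\<phi>' x * f x)) = (\<lambda>x. if x \<in> {a..b} then \<phi>' x * f x else 0)"
      by (auto simp: indicator_def)
    finally have "((\<lambda>x. \<phi>' x * f x) has_integral I) {a..b}"
      by (simp only: has_integral_restrict_UNIV)
    moreover have "((\<lambda>x. \<phi>' x * f x) has_integral (u b - u a
        - expectation (\<lambda>\<omega>. \<rho> (V \<omega>) * (indicator {a<..b} (V \<omega>) * \<phi> (V \<omega>))))) {a..b}"
      using has_integral_by_parts_weight[OF V \<rho>i D that]
      by (simp only: f_def score_tail_def u_def)
    ultimately have "u b - u a - expectation (\<lambda>\<omega>. \<rho> (V \<omega>) * (indicator {a<..b} (V \<omega>) * \<phi> (V \<omega>)))
        = (\<integral>x. (indicator {a..b} x * \<phi>' x) * f x \<partial>lborel)"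
      using has_integral_unique by (simp only: mult.assoc I_def) blast
    also have "\<dots> = expectation (\<lambda>\<omega>. indicator {a..b} (V \<omega>) * \<phi>' (V \<omega>))"
      by (rule trans[symmetric]) measurable
    finally show ?thesis by (simp add: mult_ac)
  qed
  let ?L = "expectation (\<lambda>\<omega>. \<phi>' (V \<omega>)) + expectation (\<lambda>\<omega>. \<rho> (V \<omega>) * \<phi> (V \<omega>))"
  have lim: "((\<lambda>x. expectation (\<lambda>\<omega>. indicator (S x) (V \<omega>) * h \<omega>)) \<longlongrightarrow> expectation h) at_top"
    if h: "integrable M h" and S[measurable]: "\<And>x. S x \<in> sets borel" and ev: "\<And>v. \<forall>\<^sub>F x in at_top. v \<in> S x"
    for h :: "'a \<Rightarrow> real" and S :: "real \<Rightarrow> real set"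
  proof (rule integral_dominated_convergence_at_top[where w = "\<lambda>\<omega>. \<bar>h \<omega>\<bar>"])
    note [measurable] = borel_measurable_integrable[OF h]
    show "h \<in> borel_measurable M" "(\<lambda>\<omega>. indicator (S x) (V \<omega>) * h \<omega>) \<in> borel_measurable M" for x
      by measurable
    show "integrable M (\<lambda>\<omega>. \<bar>h \<omega>\<bar>)" using h by simp
    show "\<forall>\<^sub>F x in at_top. AE \<omega> in M. norm (indicator (S x) (V \<omega>) * h \<omega>) \<le> \<bar>h \<omega>\<bar>"
      by (auto simp: indicator_def)
    show "AE \<omega> in M. ((\<lambda>x. indicator (S x) (V \<omega>) * h \<omega>) \<longlongrightarrow> h \<omega>) at_top"
    proof (intro AE_I2 tendsto_eventually)
      show "\<forall>\<^sub>F x in at_top. indicator (S x) (V \<omega>) * h \<omega> = h \<omega>" for \<omega>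
        using ev[of "V \<omega>"] by eventually_elim simp
    qed
  qed
  have ev: "\<forall>\<^sub>F x in at_top. v \<in> {-x<..x}" for v :: real
    by (rule eventually_at_top_linorderI[of "\<bar>v\<bar> + 1"]) auto
  have ev': "\<forall>\<^sub>F x in at_top. v \<in> {-x..x}" for v :: real
    using ev[of v] by eventually_elim auto
  have "((\<lambda>x. expectation (\<lambda>\<omega>. indicator {-x..x} (V \<omega>) * \<phi>' (V \<omega>))
      + expectation (\<lambda>\<omega>. indicator {-x<..x} (V \<omega>) * (\<rho> (V \<omega>) * \<phi> (V \<omega>)))) \<longlongrightarrow> ?L) at_top"
    by (intro tendsto_add lim \<phi>'i \<rho>\<phi>i ev ev') auto
  then have "((\<lambda>x. u x - u (- x)) \<longlongrightarrow> ?L) at_top"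
    by (rule Lim_transform_eventually)
      (intro eventually_at_top_linorderI[of 0], use parts in auto)
  moreover have "integrable lborel (\<lambda>x. u x - u (- x))"
    using u lborel_integrable_real_affine[OF u, of "-1" 0] by simp
  ultimately have "?L = 0"
    by (rule integrable_tendsto_at_top_imp_zero[rotated])
  then show ?thesis by simp
qed

section \<open>The score of a sum\<close>

text \<open>The function \<open>h\<close> obtained below is \<open>x \<mapsto> E[u | V = x]\<close>.\<close>

lemma (in prob_space) conditional_density_nonneg:
  assumes V[measurable]: "random_variable borel V" and u: "integrable M u" and u0: "\<And>\<omega>. u \<omega> \<ge> 0"
  obtains h :: "real \<Rightarrow> real" where "h \<in> borel_measurable borel" "integrable M (\<lambda>\<omega>. h (V \<omega>))"
    "\<And>\<phi> B. \<phi> \<in> borel_measurable borel \<Longrightarrow> (\<And>x. \<bar>\<phi> x\<bar> \<le> B) \<Longrightarrow>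
      expectation (\<lambda>\<omega>. h (V \<omega>) * \<phi> (V \<omega>)) = expectation (\<lambda>\<omega>. u \<omega> * \<phi> (V \<omega>))"
proof -
  note [measurable] = borel_measurable_integrable[OF u]
  define \<mu> where "\<mu> = distr M borel V"
  \<comment> \<open>The law of \<open>V\<close> under the measure with density \<open>u\<close>. It
    is dominated by the law of \<open>V\<close> under \<open>M\<close>, and the Radon-Nikodym
    derivative is the conditional expectation as a function of the value of
    \<open>V\<close>.\<close>
  define \<nu> where "\<nu> = distr (density M u) borel V"
  interpret \<mu>: prob_space \<mu>
    unfolding \<mu>_def by (rule prob_space_distr) simp
  have [measurable_cong]: "sets \<mu> = sets borel" "sets \<nu> = sets borel" by (simp_all add: \<mu>_def \<nu>_def)
  have fin_u: "finite_measure (density M u)"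
    using u u0 by (intro finite_measureI) (simp add: emeasure_density integrable_iff_bounded)
  then have fin: "finite_measure \<nu>"
    unfolding \<nu>_def by (rule finite_measure.finite_measure_distr) simp
  have ac: "absolutely_continuous \<mu> \<nu>"
    unfolding absolutely_continuous_def
  proof
    fix A assume A: "A \<in> null_sets \<mu>"
    then have [measurable]: "A \<in> sets borel" by (auto simp: null_sets_def \<mu>_def)
    have "V -` A \<inter> space M \<in> null_sets M"
      using A by (auto simp: null_sets_def \<mu>_def emeasure_distr)
    then have "V -` A \<inter> space M \<in> null_sets (density M u)"
      using absolutely_continuousI_density[of u M] by (auto simp: absolutely_continuous_def)
    then show "A \<in> null_sets \<nu>"
      by (auto simp: null_sets_def \<nu>_def emeasure_distr)
  qed
  \<comment> \<open>Because \<open>\<nu>\<close> is finite, the derivative has a real-valued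
    version.\<close>
  obtain D where D: "D \<in> borel_measurable \<mu>" "AE x in \<mu>. RN_deriv \<mu> \<nu> x = ennreal (D x)" "\<And>x. 0 \<le> D x"
    using \<mu>.real_RN_deriv[OF fin ac] by (auto simp: \<mu>_def \<nu>_def)
  then have [measurable]: "D \<in> borel_measurable borel" by (simp add: \<mu>_def)
  have "density \<mu> D = density \<mu> (RN_deriv \<mu> \<nu>)"
    using D by (intro density_cong) auto
  also have "\<dots> = \<nu>"
    by (rule \<mu>.density_RN_deriv[OF ac]) (simp add: \<mu>_def \<nu>_def)
  finally have dens: "density \<mu> D = \<nu>" .
  have ii: "integrable M (\<lambda>\<omega>. D (V \<omega>) * \<phi> (V \<omega>))"
    "expectation (\<lambda>\<omega>. D (V \<omega>) * \<phi> (V \<omega>)) = expectation (\<lambda>\<omega>. u \<omega> * \<phi> (V \<omega>))"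
    if [measurable]: "\<phi> \<in> borel_measurable borel" and B: "\<And>x. \<bar>\<phi> x\<bar> \<le> B" for \<phi> :: "real \<Rightarrow> real" and B
  proof -
    interpret \<nu>: finite_measure \<nu> by (rule fin)
    have "integrable \<nu> \<phi>"
      by (rule \<nu>.integrable_const_bound[where B = B]) (auto simp: B)
    then have "integrable \<mu> (\<lambda>x. D x * \<phi> x)"
      unfolding dens[symmetric] using D(3) by (subst (asm) integrable_density) auto
    then show "integrable M (\<lambda>\<omega>. D (V \<omega>) * \<phi> (V \<omega>))"
      unfolding \<mu>_def by (subst (asm) integrable_distr_eq) auto
    have "expectation (\<lambda>\<omega>. D (V \<omega>) * \<phi> (V \<omega>)) = (\<integral>x. D x * \<phi> x \<partial>\<mu>)"
      unfolding \<mu>_def by (subst integral_distr) auto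
    also have "\<dots> = integral\<^sup>L \<nu> \<phi>"
      unfolding dens[symmetric] using D(3) by (subst integral_density) auto
    also have "\<dots> = (\<integral>\<omega>. \<phi> (V \<omega>) \<partial>density M u)"
      unfolding \<nu>_def by (subst integral_distr) auto
    also have "\<dots> = expectation (\<lambda>\<omega>. u \<omega> * \<phi> (V \<omega>))"
      using u0 by (subst integral_density) auto
    finally show "expectation (\<lambda>\<omega>. D (V \<omega>) * \<phi> (V \<omega>)) = expectation (\<lambda>\<omega>. u \<omega> * \<phi> (V \<omega>))" .
  qed
  show ?thesis
    using ii(1)[of "\<lambda>_. 1" 1] ii(2) by (intro that[of D]) auto
qed

lemma (in prob_space) integrable_mult_bounded:
  fixes u :: "'a \<Rightarrow> real"
  assumes u: "integrable M u" and [measurable]: "w \<in> borel_measurable M" and B: "\<And>\<omega>. \<bar>w \<omega>\<bar> \<le> B"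
  shows "integrable M (\<lambda>\<omega>. u \<omega> * w \<omega>)"
proof (rule Bochner_Integration.integrable_bound[OF integrable_mult_right[OF u, of B]])
  note [measurable] = borel_measurable_integrable[OF u]
  show "(\<lambda>\<omega>. u \<omega> * w \<omega>) \<in> borel_measurable M" by measurable
  show "AE \<omega> in M. norm (u \<omega> * w \<omega>) \<le> norm (B * u \<omega>)"
  proof (rule AE_I2)
    fix \<omega>
    have "\<bar>w \<omega>\<bar> * \<bar>u \<omega>\<bar> \<le> \<bar>B\<bar> * \<bar>u \<omega>\<bar>"
      using B[of \<omega>] by (intro mult_right_mono) auto
    then show "norm (u \<omega> * w \<omega>) \<le> norm (B * u \<omega>)" by (simp add: abs_mult mult.commute)
  qed
qed

text \<open>Difference of the nonnegative cases for the positive and negative parts of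
  \<open>u\<close>. The test functions are bounded because \<open>u\<close> is only
  integrable.\<close>

lemma (in prob_space) conditional_density:
  assumes V[measurable]: "random_variable borel V" and u: "integrable M u"
  obtains h :: "real \<Rightarrow> real" where "h \<in> borel_measurable borel" "integrable M (\<lambda>\<omega>. h (V \<omega>))"
    "\<And>\<phi> B. \<phi> \<in> borel_measurable borel \<Longrightarrow> (\<And>x. \<bar>\<phi> x\<bar> \<le> B) \<Longrightarrow>
      expectation (\<lambda>\<omega>. h (V \<omega>) * \<phi> (V \<omega>)) = expectation (\<lambda>\<omega>. u \<omega> * \<phi> (V \<omega>))"
proof -
  note [measurable] = borel_measurable_integrable[OF u]
  define p where "p \<omega> = max 0 (u \<omega>)" for \<omega>
  define q where "q \<omega> = max 0 (- u \<omega>)" for \<omega>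
  have p: "integrable M p" and q: "integrable M q"
    unfolding p_def q_def by (auto intro!: Bochner_Integration.integrable_bound[OF u])
  have u_eq: "u \<omega> = p \<omega> - q \<omega>" for \<omega> by (auto simp: p_def q_def)
  obtain hp :: "real \<Rightarrow> real" where hp: "hp \<in> borel_measurable borel" "integrable M (\<lambda>\<omega>. hp (V \<omega>))"
    "\<And>\<phi> B. \<phi> \<in> borel_measurable borel \<Longrightarrow> (\<And>x. \<bar>\<phi> x\<bar> \<le> B) \<Longrightarrow>
      expectation (\<lambda>\<omega>. hp (V \<omega>) * \<phi> (V \<omega>)) = expectation (\<lambda>\<omega>. p \<omega> * \<phi> (V \<omega>))"
    by (rule conditional_density_nonneg[OF V p]) (auto simp: p_def)
  obtain hq :: "real \<Rightarrow> real" where hq: "hq \<in> borel_measurable borel" "integrable M (\<lambda>\<omega>. hq (V \<omega>))"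
    "\<And>\<phi> B. \<phi> \<in> borel_measurable borel \<Longrightarrow> (\<And>x. \<bar>\<phi> x\<bar> \<le> B) \<Longrightarrow>
      expectation (\<lambda>\<omega>. hq (V \<omega>) * \<phi> (V \<omega>)) = expectation (\<lambda>\<omega>. q \<omega> * \<phi> (V \<omega>))"
    by (rule conditional_density_nonneg[OF V q]) (auto simp: q_def)
  show ?thesis
  proof (rule that[of "\<lambda>x. hp x - hq x"])
    show "(\<lambda>x. hp x - hq x) \<in> borel_measurable borel" "integrable M (\<lambda>\<omega>. hp (V \<omega>) - hq (V \<omega>))"
      using hp hq by auto
    fix \<phi> :: "real \<Rightarrow> real" and B assume [measurable]: "\<phi> \<in> borel_measurable borel" and B: "\<And>x. \<bar>\<phi> x\<bar> \<le> B"
    have i: "integrable M (\<lambda>\<omega>. v \<omega> * \<phi> (V \<omega>))" if "integrable M v" for v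
      by (rule integrable_mult_bounded[OF that _ B]) measurable
    have "expectation (\<lambda>\<omega>. (hp (V \<omega>) - hq (V \<omega>)) * \<phi> (V \<omega>))
        = expectation (\<lambda>\<omega>. hp (V \<omega>) * \<phi> (V \<omega>)) - expectation (\<lambda>\<omega>. hq (V \<omega>) * \<phi> (V \<omega>))"
      unfolding left_diff_distrib by (rule Bochner_Integration.integral_diff[OF i[OF hp(2)] i[OF hq(2)]])
    also have "\<dots> = expectation (\<lambda>\<omega>. p \<omega> * \<phi> (V \<omega>)) - expectation (\<lambda>\<omega>. q \<omega> * \<phi> (V \<omega>))"
      using hp(3)[of \<phi> B] hq(3)[of \<phi> B] B by simp
    also have "\<dots> = expectation (\<lambda>\<omega>. u \<omega> * \<phi> (V \<omega>))"
      unfolding u_eq left_diff_distrib by (rule Bochner_Integration.integral_diff[OF i[OF p] i[OF q], symmetric])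
    finally show "expectation (\<lambda>\<omega>. (hp (V \<omega>) - hq (V \<omega>)) * \<phi> (V \<omega>)) = expectation (\<lambda>\<omega>. u \<omega> * \<phi> (V \<omega>))" .
  qed
qed

section \<open>Existence of a score for an independent sum\<close>

lemma test_function_DERIV:
  "test_function \<phi> \<Longrightarrow> (\<phi> has_real_derivative deriv \<phi> x) (at x)"
  by (simp add: test_function_iff_smooth smooth_DERIV)

lemma test_function_affine:
  assumes \<phi>: "test_function \<phi>" and "m \<noteq> 0"
  shows "test_function (\<lambda>x. \<phi> (m * x + b))"
proof -
  have "bounded {x. \<phi> x \<noteq> 0}"
    using \<phi> unfolding test_function_iff_smooth
    by (meson bounded_subset closure_subset compact_imp_bounded)
  then obtain K where K: "\<And>x. \<phi> x \<noteq> 0 \<Longrightarrow> \<bar>x\<bar> \<le> K"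
    by (auto simp: bounded_iff)
  have "\<bar>x\<bar> \<le> (K + \<bar>b\<bar>) / \<bar>m\<bar>" if "\<phi> (m * x + b) \<noteq> 0" for x
  proof -
    have "\<bar>m * x\<bar> \<le> K + \<bar>b\<bar>" using K[OF that] by linarith
    then show ?thesis using \<open>m \<noteq> 0\<close> by (simp add: abs_mult field_simps)
  qed
  then have "bounded {x. \<phi> (m * x + b) \<noteq> 0}"
    by (auto simp: bounded_iff)
  then show ?thesis
    using \<phi> smooth_affine[of \<phi> 1 m b] by (simp add: test_function_iff_smooth)
qed

lemma test_function_bounded:
  assumes \<phi>: "test_function \<phi>"
  obtains B where "\<And>x. \<bar>\<phi> x\<bar> \<le> B" "\<And>x. \<bar>deriv \<phi> x\<bar> \<le> B"
proof -
  let ?S = "closure {x. \<phi> x \<noteq> 0}"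
  have S: "compact ?S" and s: "smooth \<phi>" "smooth (deriv \<phi>)"
    using \<phi> by (auto simp: test_function_iff_smooth smooth_deriv)
  have out: "\<phi> x = 0" if "x \<notin> ?S" for x
    using that closure_subset[of "{x. \<phi> x \<noteq> 0}"] by blast
  \<comment> \<open>The complement of the closed support is open and \<open>\<phi>\<close> is 0 on
    it, so the derivative is 0 there too.\<close>
  have out': "deriv \<phi> x = 0" if "x \<notin> ?S" for x
  proof -
    have "((\<lambda>_. 0) has_real_derivative 0) (at x)" by simp
    then have "(\<phi> has_real_derivative 0) (at x)"
      by (rule has_field_derivative_transform_within_open[OF _ open_Compl[OF closed_closure] Compl_iff[THEN iffD2, OF that]])
        (rule out[symmetric], erule ComplD)
    then show ?thesis by (rule DERIV_imp_deriv)
  qed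
  have on_S: "\<exists>B. \<forall>x\<in>?S. \<bar>\<psi> x\<bar> \<le> B" if "smooth \<psi>" for \<psi>
    using compact_imp_bounded[OF compact_continuous_image[OF smooth_continuous_on[OF that] S]]
    by (auto simp: bounded_iff)
  obtain B1 where "\<forall>x\<in>?S. \<bar>\<phi> x\<bar> \<le> B1"
    using on_S[OF s(1)] by blast
  moreover obtain B2 where "\<forall>x\<in>?S. \<bar>deriv \<phi> x\<bar> \<le> B2"
    using on_S[OF s(2)] by blast
  ultimately have "\<bar>\<phi> x\<bar> \<le> max 0 (max B1 B2)" "\<bar>deriv \<phi> x\<bar> \<le> max 0 (max B1 B2)" for x
    using out[of x] out'[of x] by (cases "x \<in> ?S"; force)+
  then show ?thesis by (rule that)
qed

text \<open>The score of a sum is the conditional expectation, given the sum, of the score of one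
  summand. By independence the other summand may be frozen at a value \<open>z\<close>, and the
  identity for \<open>X\<close> is applied to a shifted and rescaled test function before
  integrating over \<open>z\<close>.\<close>

lemma (in prob_space) score_exists_add_indep:
  assumes ind: "indep_var borel X borel Z" and \<rho>: "is_score M X \<rho>" and "c \<noteq> 0"
  shows "\<exists>\<sigma>. is_score M (\<lambda>\<omega>. c * (X \<omega> + Z \<omega>)) \<sigma>"
proof -
  have [measurable]: "random_variable borel X" "random_variable borel Z"
    and prod: "distr M borel X \<Otimes>\<^sub>M distr M borel Z = distr M (borel \<Otimes>\<^sub>M borel) (\<lambda>\<omega>. (X \<omega>, Z \<omega>))"
    using ind by (auto simp: indep_var_distribution_eq)
  have [measurable]: "\<rho> \<in> borel_measurable borel" and \<rho>i: "integrable M (\<lambda>\<omega>. \<rho> (X \<omega>))"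
    using \<rho> by (auto simp: is_score_def)
  let ?V = "\<lambda>\<omega>. c * (X \<omega> + Z \<omega>)"
  let ?PX = "distr M borel X" and ?PZ = "distr M borel Z"
  interpret PX: prob_space ?PX by (rule prob_space_distr) simp
  interpret PZ: prob_space ?PZ by (rule prob_space_distr) simp
  interpret P: pair_sigma_finite ?PX ?PZ ..
  have iter: "expectation (\<lambda>\<omega>. F (X \<omega>) (Z \<omega>)) = (\<integral>z. (\<integral>x. F x z \<partial>?PX) \<partial>?PZ)"
    if F: "case_prod F \<in> borel_measurable (borel \<Otimes>\<^sub>M borel)" and i: "integrable M (\<lambda>\<omega>. F (X \<omega>) (Z \<omega>))"
    for F :: "real \<Rightarrow> real \<Rightarrow> real"
  proof -
    have "integrable (?PX \<Otimes>\<^sub>M ?PZ) (case_prod F)"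
      unfolding prod using F i by (subst integrable_distr_eq) auto
    from P.integral_snd[OF this]
    have "(\<integral>z. (\<integral>x. F x z \<partial>?PX) \<partial>?PZ) = integral\<^sup>L (?PX \<Otimes>\<^sub>M ?PZ) (case_prod F)" by simp
    also have "\<dots> = expectation (\<lambda>\<omega>. F (X \<omega>) (Z \<omega>))"
      unfolding prod using F by (subst integral_distr) auto
    finally show ?thesis by simp
  qed
  obtain h :: "real \<Rightarrow> real" where h: "h \<in> borel_measurable borel" "integrable M (\<lambda>\<omega>. h (?V \<omega>))"
    "\<And>\<phi> B. \<phi> \<in> borel_measurable borel \<Longrightarrow> (\<And>x. \<bar>\<phi> x\<bar> \<le> B) \<Longrightarrow>
      expectation (\<lambda>\<omega>. h (?V \<omega>) * \<phi> (?V \<omega>)) = expectation (\<lambda>\<omega>. \<rho> (X \<omega>) * \<phi> (?V \<omega>))"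
    by (rule conditional_density[of ?V "\<lambda>\<omega>. \<rho> (X \<omega>)"]) (use \<rho>i in auto)
  \<comment> \<open>The division undoes the factor \<open>c\<close> that the chain rule produces for
    the rescaled test function.\<close>
  have "is_score M ?V (\<lambda>x. h x / c)"
    unfolding is_score_def
  proof (intro conjI allI impI)
    show "(\<lambda>x. h x / c) \<in> borel_measurable borel" "integrable M (\<lambda>\<omega>. h (?V \<omega>) / c)"
      using h by auto
    fix \<phi> assume \<phi>: "test_function \<phi>"
    then have [measurable]: "\<phi> \<in> borel_measurable borel" "deriv \<phi> \<in> borel_measurable borel"
      by (auto simp: test_function_iff_smooth smooth_deriv intro!: smooth_borel_measurable)
    obtain B where B: "\<And>x. \<bar>\<phi> x\<bar> \<le> B" "\<And>x. \<bar>deriv \<phi> x\<bar> \<le> B"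
      using test_function_bounded[OF \<phi>] by blast
    have inner: "(\<integral>x. \<rho> x * \<phi> (c * (x + z)) \<partial>?PX) = (\<integral>x. - c * deriv \<phi> (c * (x + z)) \<partial>?PX)" for z
    proof -
      let ?\<psi> = "\<lambda>x. \<phi> (c * x + c * z)"
      have "(?\<psi> has_real_derivative deriv \<phi> (c * x + c * z) * c) (at x)" for x
        by (rule DERIV_chain2[OF test_function_DERIV[OF \<phi>]]) (auto intro!: derivative_eq_intros)
      then have d: "deriv ?\<psi> = (\<lambda>x. deriv \<phi> (c * x + c * z) * c)"
        by (auto intro: DERIV_imp_deriv)
      have "(\<integral>x. \<rho> x * \<phi> (c * (x + z)) \<partial>?PX) = expectation (\<lambda>\<omega>. \<rho> (X \<omega>) * ?\<psi> (X \<omega>))"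
        by (subst integral_distr) (auto simp: distrib_left)
      also have "\<dots> = - expectation (\<lambda>\<omega>. deriv ?\<psi> (X \<omega>))"
        using \<rho> test_function_affine[OF \<phi> \<open>c \<noteq> 0\<close>, of "c * z"] unfolding is_score_def by blast
      also have "\<dots> = (\<integral>x. - c * deriv \<phi> (c * (x + z)) \<partial>?PX)"
        unfolding d by (subst integral_distr) (auto simp: distrib_left mult.commute)
      finally show ?thesis .
    qed
    have "integrable M (\<lambda>\<omega>. deriv \<phi> (?V \<omega>))"
      by (rule integrable_const_bound[where B = B]) (auto simp: B)
    have "expectation (\<lambda>\<omega>. h (?V \<omega>) * \<phi> (?V \<omega>)) = expectation (\<lambda>\<omega>. \<rho> (X \<omega>) * \<phi> (?V \<omega>))"
      by (rule h(3)[OF _ B(1)]) measurable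
    also have "\<dots> = (\<integral>z. (\<integral>x. \<rho> x * \<phi> (c * (x + z)) \<partial>?PX) \<partial>?PZ)"
      by (rule iter) (auto intro!: integrable_mult_bounded[OF \<rho>i _ B(1)])
    also have "\<dots> = expectation (\<lambda>\<omega>. - c * deriv \<phi> (c * (X \<omega> + Z \<omega>)))"
      unfolding inner
      by (rule iter[symmetric]) (use \<open>integrable M (\<lambda>\<omega>. deriv \<phi> (?V \<omega>))\<close> in auto)
    finally show "expectation (\<lambda>\<omega>. h (?V \<omega>) / c * \<phi> (?V \<omega>)) = - expectation (\<lambda>\<omega>. deriv \<phi> (?V \<omega>))"
      using \<open>c \<noteq> 0\<close> by (simp add: field_simps)
  qed
  then show ?thesis by blast
qed

section \<open>The variational formula\<close>

text \<open>The uniform bound \<open>k\<close> provides the majorants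
  \<open>\<bar>u\<bar> * k\<close> and \<open>k\<^sup>2\<close>, so both sides converge. It serves
  for the passage from C1 to continuous and from continuous to Borel functions.\<close>

lemma (in prob_space) expectation_square_ineq_limit:
  fixes u :: "'a \<Rightarrow> real"
  assumes u: "integrable M u"
    and gm: "\<And>j::nat. g j \<in> borel_measurable M" and g'm: "g' \<in> borel_measurable M"
    and bd: "\<And>j \<omega>. \<bar>g j \<omega>\<bar> \<le> k"
    and lim: "AE \<omega> in M. (\<lambda>j. g j \<omega>) \<longlonglongrightarrow> g' \<omega>"
    and ineq: "\<And>j. (expectation (\<lambda>\<omega>. u \<omega> * g j \<omega>))\<^sup>2 \<le> S * expectation (\<lambda>\<omega>. (g j \<omega>)\<^sup>2)"
  shows "(expectation (\<lambda>\<omega>. u \<omega> * g' \<omega>))\<^sup>2 \<le> S * expectation (\<lambda>\<omega>. (g' \<omega>)\<^sup>2)"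
proof (rule LIMSEQ_le)
  note [measurable] = gm g'm borel_measurable_integrable[OF u]
  have "(\<lambda>j. expectation (\<lambda>\<omega>. u \<omega> * g j \<omega>)) \<longlonglongrightarrow> expectation (\<lambda>\<omega>. u \<omega> * g' \<omega>)"
  proof (rule integral_dominated_convergence[where w = "\<lambda>\<omega>. \<bar>u \<omega>\<bar> * k"])
    show "integrable M (\<lambda>\<omega>. \<bar>u \<omega>\<bar> * k)" using u by simp
    show "AE \<omega> in M. (\<lambda>j. u \<omega> * g j \<omega>) \<longlonglongrightarrow> u \<omega> * g' \<omega>"
      using lim by eventually_elim (rule tendsto_mult_left)
    show "AE \<omega> in M. norm (u \<omega> * g j \<omega>) \<le> \<bar>u \<omega>\<bar> * k" for j
      by (intro AE_I2) (simp add: abs_mult bd mult_left_mono)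
  qed measurable
  then show "(\<lambda>j. (expectation (\<lambda>\<omega>. u \<omega> * g j \<omega>))\<^sup>2) \<longlonglongrightarrow> (expectation (\<lambda>\<omega>. u \<omega> * g' \<omega>))\<^sup>2"
    by (rule tendsto_power)
  have "(\<lambda>j. expectation (\<lambda>\<omega>. (g j \<omega>)\<^sup>2)) \<longlonglongrightarrow> expectation (\<lambda>\<omega>. (g' \<omega>)\<^sup>2)"
  proof (rule integral_dominated_convergence[where w = "\<lambda>\<omega>. k\<^sup>2"])
    show "AE \<omega> in M. (\<lambda>j. (g j \<omega>)\<^sup>2) \<longlonglongrightarrow> (g' \<omega>)\<^sup>2"
      using lim by eventually_elim (rule tendsto_power)
    show "AE \<omega> in M. norm ((g j \<omega>)\<^sup>2) \<le> k\<^sup>2" for j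
      by (intro AE_I2) (simp add: power2_le_iff_abs_le abs_le_square_iff[symmetric] bd order_trans[OF bd])
  qed auto
  then show "(\<lambda>j. S * expectation (\<lambda>\<omega>. (g j \<omega>)\<^sup>2)) \<longlonglongrightarrow> S * expectation (\<lambda>\<omega>. (g' \<omega>)\<^sup>2)"
    by (rule tendsto_mult_left)
qed (use ineq in auto)

text \<open>The approximants are the means of \<open>g\<close> over the intervals from
  \<open>x\<close> to \<open>x + 1/(j+1)\<close>, written through a primitive \<open>G\<close>.
  Means inherit the bound \<open>k\<close>, and their derivatives are difference quotients of
  \<open>g\<close>, bounded for each \<open>j\<close> separately.\<close>

lemma continuous_bounded_C1_approximation:
  fixes g :: "real \<Rightarrow> real"
  assumes cont: "continuous_on UNIV g" and bd: "\<And>x. \<bar>g x\<bar> \<le> k"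
  obtains \<phi> \<phi>' :: "nat \<Rightarrow> real \<Rightarrow> real" and B where
    "\<And>j x. (\<phi> j has_real_derivative \<phi>' j x) (at x)" "\<And>j x. \<bar>\<phi> j x\<bar> \<le> k" "\<And>j x. \<bar>\<phi>' j x\<bar> \<le> B j"
    "\<And>x. (\<lambda>j. \<phi> j x) \<longlonglongrightarrow> g x"
proof -
  obtain G where G: "\<And>x. (G has_real_derivative g x) (at x)"
    using antiderivative_exists[OF cont] by metis
  define e where "e j = inverse (real (Suc j))" for j
  have e: "e j > 0" for j by (simp add: e_def)
  define \<phi> where "\<phi> j x = (G (x + e j) - G x) / e j" for j x
  define \<phi>' where "\<phi>' j x = (g (x + e j) - g x) / e j" for j x
  have "((\<lambda>x. G (x + e j)) has_real_derivative g (x + e j) * 1) (at x)" for j x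
    by (rule DERIV_chain2[OF G]) (auto intro!: derivative_eq_intros)
  from DERIV_cdivide[OF DERIV_diff[OF this G]]
  have "(\<phi> j has_real_derivative \<phi>' j x) (at x)" for j x
    unfolding \<phi>_def[abs_def] \<phi>'_def by simp
  moreover have "\<bar>\<phi> j x\<bar> \<le> k" for j x
  proof -
    obtain z where "G (x + e j) - G x = (x + e j - x) * g z"
      using MVT2[of x "x + e j" G g] G e by auto
    then show ?thesis using e[of j] bd[of z] by (simp add: \<phi>_def)
  qed
  moreover have "\<bar>\<phi>' j x\<bar> \<le> 2 * k / e j" for j x
    using bd[of x] bd[of "x + e j"] e[of j] by (simp add: \<phi>'_def abs_divide divide_right_mono)
  moreover have "(\<lambda>j. \<phi> j x) \<longlonglongrightarrow> g x" for x
    using G[of x] LIMSEQ_inverse_real_of_nat unfolding DERIV_def tendsto_at_iff_sequentially \<phi>_def e_def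
    by (auto simp: o_def dest!: spec[of _ "\<lambda>n. inverse (real (Suc n))"])
  ultimately show ?thesis by (rule that)
qed

text \<open>Two limit passages, from C1 to continuous and from continuous to Borel functions. The
  second converges only off a Lebesgue null set; the score enters here because it gives
  \<open>V\<close> a density, so that its law does not charge this set.\<close>

lemma (in prob_space) expectation_square_ineq_borel:
  fixes h :: "real \<Rightarrow> real"
  assumes V[measurable]: "random_variable borel V" and \<rho>: "is_score M V \<rho>"
    and [measurable]: "h \<in> borel_measurable borel" and hi: "integrable M (\<lambda>\<omega>. h (V \<omega>))"
    and C1: "\<And>\<phi> \<phi>' B B'. (\<And>x. (\<phi> has_real_derivative \<phi>' x) (at x)) \<Longrightarrow> (\<And>x. \<bar>\<phi> x\<bar> \<le> B) \<Longrightarrow> (\<And>x. \<bar>\<phi>' x\<bar> \<le> B')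
      \<Longrightarrow> (expectation (\<lambda>\<omega>. h (V \<omega>) * \<phi> (V \<omega>)))\<^sup>2 \<le> S * expectation (\<lambda>\<omega>. (\<phi> (V \<omega>))\<^sup>2)"
    and g[measurable]: "g \<in> borel_measurable borel" and bd: "\<And>x. \<bar>g x\<bar> \<le> k"
  shows "(expectation (\<lambda>\<omega>. h (V \<omega>) * g (V \<omega>)))\<^sup>2 \<le> S * expectation (\<lambda>\<omega>. (g (V \<omega>))\<^sup>2)"
proof -
  have cont_case: "(expectation (\<lambda>\<omega>. h (V \<omega>) * c (V \<omega>)))\<^sup>2 \<le> S * expectation (\<lambda>\<omega>. (c (V \<omega>))\<^sup>2)"
    if c: "continuous_on UNIV c" and cb: "\<And>x. \<bar>c x\<bar> \<le> k" for c :: "real \<Rightarrow> real"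
  proof -
    obtain \<phi> \<phi>' :: "nat \<Rightarrow> real \<Rightarrow> real" and B where \<phi>:
      "\<And>j x. (\<phi> j has_real_derivative \<phi>' j x) (at x)" "\<And>j x. \<bar>\<phi> j x\<bar> \<le> k" "\<And>j x. \<bar>\<phi>' j x\<bar> \<le> B j"
      "\<And>x. (\<lambda>j. \<phi> j x) \<longlonglongrightarrow> c x"
      by (rule continuous_bounded_C1_approximation[OF c cb]) blast
    have [measurable]: "\<phi> j \<in> borel_measurable borel" "c \<in> borel_measurable borel" for j
      by (auto intro!: borel_measurable_continuous_onI continuous_at_imp_continuous_on DERIV_isCont[OF \<phi>(1)] c)
    show ?thesis
    proof (rule expectation_square_ineq_limit[OF hi, where g = "\<lambda>j \<omega>. \<phi> j (V \<omega>)" and k = k])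
      show "(expectation (\<lambda>\<omega>. h (V \<omega>) * \<phi> j (V \<omega>)))\<^sup>2 \<le> S * expectation (\<lambda>\<omega>. (\<phi> j (V \<omega>))\<^sup>2)" for j
        by (rule C1[OF \<phi>(1) \<phi>(2) \<phi>(3)])
    qed (auto simp: \<phi>)
  qed
  \<comment> \<open>This notion of measurability means being a limit of continuous functions off a
    negligible set.\<close>
  have "g measurable_on UNIV"
    by (rule lebesgue_measurable_imp_measurable_on) (auto intro: measurable_completion)
  then obtain N c where N: "negligible N" and c: "\<And>n. continuous_on UNIV (c n)"
    "\<And>x. x \<notin> N \<Longrightarrow> (\<lambda>n. c n x) \<longlonglongrightarrow> g x"
    unfolding measurable_on_def by auto
  \<comment> \<open>The negligible set is enlarged to a Borel null set, so that its preimage under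
    \<open>V\<close> is an event.\<close>
  obtain N' where N': "N' \<in> null_sets lborel" "N \<subseteq> N'"
    using N unfolding negligible_iff_null_sets null_sets_completion_iff2 by blast
  then have [measurable]: "N' \<in> sets borel" by auto
  have "AE x in lborel. x \<notin> N'"
    using N'(1) by (rule AE_not_in)
  then have "AE x in density lborel (score_tail V \<rho>). x \<notin> N'"
    using score_tail_measurable[OF V \<rho>] by (subst AE_density) auto
  then have "AE \<omega> in M. V \<omega> \<notin> N'"
    unfolding distr_eq_density_score_tail[OF V \<rho>, symmetric] by (subst (asm) AE_distr_iff) auto
  \<comment> \<open>Clamping restores a uniform bound on the approximants and does not disturb the
    limit, as \<open>g\<close> itself takes values in the same range.\<close>
  define d where "d n x = max (- k) (min k (c n x))" for n x
  have dc: "continuous_on UNIV (d n)" for n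
    unfolding d_def[abs_def] by (intro continuous_intros c)
  have k0: "k \<ge> 0" using bd[of 0] by linarith
  have db: "\<bar>d n x\<bar> \<le> k" for n x
    using k0 by (auto simp: d_def)
  have [measurable]: "d n \<in> borel_measurable borel" for n
    by (rule borel_measurable_continuous_onI[OF dc])
  show ?thesis
  proof (rule expectation_square_ineq_limit[OF hi, where g = "\<lambda>j \<omega>. d j (V \<omega>)" and k = k])
    show "AE \<omega> in M. (\<lambda>j. d j (V \<omega>)) \<longlonglongrightarrow> g (V \<omega>)"
      using \<open>AE \<omega> in M. V \<omega> \<notin> N'\<close>
    proof eventually_elim
      case (elim \<omega>)
      then have "(\<lambda>n. max (- k) (min k (c n (V \<omega>)))) \<longlonglongrightarrow> max (- k) (min k (g (V \<omega>)))"
        using N' by (intro tendsto_intros c(2)) auto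
      then show ?case
        using bd[of "V \<omega>"] by (simp add: d_def abs_le_iff min_absorb2 max_absorb2)
    qed
    show "(expectation (\<lambda>\<omega>. h (V \<omega>) * d j (V \<omega>)))\<^sup>2 \<le> S * expectation (\<lambda>\<omega>. (d j (V \<omega>))\<^sup>2)" for j
      by (rule cont_case[OF dc db])
  qed (auto simp: db)
qed

text \<open>For the truncation \<open>t k\<close> the product with \<open>u\<close> dominates the
  square, so the hypothesis becomes e^2 \<le> S e for the second moment e of \<open>t k\<close>,
  whence e \<le> S. Every quantity is finite before the limit in \<open>k\<close> is taken.\<close>

lemma (in prob_space) nn_integral_square_le_of_truncations:
  fixes u :: "'a \<Rightarrow> real"
  assumes u: "integrable M u"
    and ineq: "\<And>k::nat. (expectation (\<lambda>\<omega>. u \<omega> * max (- real k) (min (real k) (u \<omega>))))\<^sup>2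
      \<le> S * expectation (\<lambda>\<omega>. (max (- real k) (min (real k) (u \<omega>)))\<^sup>2)"
    and "S \<ge> 0"
  shows "(\<integral>\<^sup>+\<omega>. ennreal ((u \<omega>)\<^sup>2) \<partial>M) \<le> ennreal S"
proof -
  note [measurable] = borel_measurable_integrable[OF u]
  define t where "t k \<omega> = max (- real k) (min (real k) (u \<omega>))" for k :: nat and \<omega>
  have tb: "\<bar>t k \<omega>\<bar> \<le> real k" for k \<omega> by (auto simp: t_def)
  have [measurable]: "t k \<in> borel_measurable M" for k unfolding t_def by measurable
  have t2: "integrable M (\<lambda>\<omega>. (t k \<omega>)\<^sup>2)" for k
  proof (rule integrable_const_bound[where B = "(real k)\<^sup>2"])
    show "AE \<omega> in M. norm ((t k \<omega>)\<^sup>2) \<le> (real k)\<^sup>2"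
      using tb[of k] by (intro AE_I2) (simp flip: abs_le_square_iff)
  qed measurable
  have ut: "(t k \<omega>)\<^sup>2 \<le> u \<omega> * t k \<omega>" for k \<omega>
  proof -
    consider "u \<omega> \<ge> real k" | "u \<omega> \<le> - real k" | "t k \<omega> = u \<omega>"
      unfolding t_def by linarith
    then show ?thesis
    proof cases
      case 1
      then have "t k \<omega> = real k" by (auto simp: t_def)
      then show ?thesis using 1 by (simp add: power2_eq_square mult_right_mono)
    next
      case 2
      then have "t k \<omega> = - real k" by (auto simp: t_def)
      then show ?thesis using 2 mult_right_mono[of "real k" "- u \<omega>" "real k"] by (simp add: power2_eq_square)
    qed (simp add: power2_eq_square)
  qed
  have E: "expectation (\<lambda>\<omega>. (t k \<omega>)\<^sup>2) \<le> S" for k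
  proof -
    let ?e = "expectation (\<lambda>\<omega>. (t k \<omega>)\<^sup>2)"
    have "?e \<le> expectation (\<lambda>\<omega>. u \<omega> * t k \<omega>)"
      by (intro integral_mono t2 ut integrable_mult_bounded[OF u _ tb]) measurable
    moreover have "0 \<le> ?e" by simp
    ultimately have "?e\<^sup>2 \<le> S * ?e"
      using ineq[of k] power_mono[of ?e _ 2] unfolding t_def[symmetric] by fastforce
    \<comment> \<open>For a positive second moment one factor cancels; if it is 0, the claim is
      \<open>S \<ge> 0\<close>.\<close>
    then show ?thesis
      using \<open>0 \<le> ?e\<close> \<open>S \<ge> 0\<close> mult_right_le_imp_le[of ?e ?e S]
      unfolding power2_eq_square[of ?e] by linarith
  qed
  \<comment> \<open>At each point the truncation is eventually \<open>u\<close> itself, so Fatou's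
    lemma carries the bound to \<open>u\<close>.\<close>
  have "(\<integral>\<^sup>+\<omega>. ennreal ((u \<omega>)\<^sup>2) \<partial>M) \<le> (\<integral>\<^sup>+\<omega>. liminf (\<lambda>k. ennreal ((t k \<omega>)\<^sup>2)) \<partial>M)"
  proof (rule nn_integral_mono)
    fix \<omega>
    obtain k0 :: nat where "\<bar>u \<omega>\<bar> < real k0" using reals_Archimedean2 by blast
    then have "ennreal ((t k \<omega>)\<^sup>2) = ennreal ((u \<omega>)\<^sup>2)" if "k \<ge> k0" for k
      using that by (auto simp: t_def)
    then have "\<forall>\<^sub>F k in sequentially. ennreal ((t k \<omega>)\<^sup>2) = ennreal ((u \<omega>)\<^sup>2)"
      unfolding eventually_sequentially by blast
    then show "ennreal ((u \<omega>)\<^sup>2) \<le> liminf (\<lambda>k. ennreal ((t k \<omega>)\<^sup>2))"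
      by (intro Liminf_bounded) (auto elim: eventually_mono)
  qed
  also have "\<dots> \<le> liminf (\<lambda>k. \<integral>\<^sup>+\<omega>. ennreal ((t k \<omega>)\<^sup>2) \<partial>M)"
    by (rule nn_integral_liminf) measurable
  also have "\<dots> \<le> ennreal S"
    by (rule Liminf_le[OF trivial_limit_sequentially always_eventually])
      (use E in \<open>simp add: nn_integral_eq_integral[OF t2] ennreal_leI\<close>)
  finally show ?thesis .
qed

section \<open>Cauchy-Schwarz and the formula for a single variable\<close>

lemma (in prob_space) integrable_mult_of_square_integrable:
  fixes f g :: "'a \<Rightarrow> real"
  assumes [measurable]: "f \<in> borel_measurable M" "g \<in> borel_measurable M"
    and f: "integrable M (\<lambda>\<omega>. (f \<omega>)\<^sup>2)" and g: "integrable M (\<lambda>\<omega>. (g \<omega>)\<^sup>2)"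
  shows "integrable M (\<lambda>\<omega>. f \<omega> * g \<omega>)"
proof (rule Bochner_Integration.integrable_bound[OF Bochner_Integration.integrable_add[OF f g]])
  show "AE \<omega> in M. norm (f \<omega> * g \<omega>) \<le> norm ((f \<omega>)\<^sup>2 + (g \<omega>)\<^sup>2)"
  proof (rule AE_I2)
    fix \<omega>
    have "2 * \<bar>f \<omega>\<bar> * \<bar>g \<omega>\<bar> \<le> (f \<omega>)\<^sup>2 + (g \<omega>)\<^sup>2"
      using sum_squares_bound[of "\<bar>f \<omega>\<bar>" "\<bar>g \<omega>\<bar>"] by simp
    moreover have "0 \<le> \<bar>f \<omega>\<bar> * \<bar>g \<omega>\<bar>" by simp
    ultimately have "\<bar>f \<omega>\<bar> * \<bar>g \<omega>\<bar> \<le> (f \<omega>)\<^sup>2 + (g \<omega>)\<^sup>2"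
      by linarith
    then show "norm (f \<omega> * g \<omega>) \<le> norm ((f \<omega>)\<^sup>2 + (g \<omega>)\<^sup>2)"
      by (simp add: abs_mult)
  qed
qed measurable

lemma (in prob_space) expectation_mult_square_le:
  fixes f g :: "'a \<Rightarrow> real"
  assumes [measurable]: "f \<in> borel_measurable M" "g \<in> borel_measurable M"
    and fg: "integrable M (\<lambda>\<omega>. f \<omega> * g \<omega>)"
  shows "ennreal ((expectation (\<lambda>\<omega>. f \<omega> * g \<omega>))\<^sup>2)
    \<le> (\<integral>\<^sup>+\<omega>. ennreal ((f \<omega>)\<^sup>2) \<partial>M) * (\<integral>\<^sup>+\<omega>. ennreal ((g \<omega>)\<^sup>2) \<partial>M)"
proof -
  have "ennreal ((expectation (\<lambda>\<omega>. f \<omega> * g \<omega>))\<^sup>2) = (ennreal (norm (expectation (\<lambda>\<omega>. f \<omega> * g \<omega>))))\<^sup>2"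
    by (simp add: ennreal_power)
  also have "\<dots> \<le> (\<integral>\<^sup>+\<omega>. ennreal (norm (f \<omega> * g \<omega>)) \<partial>M)\<^sup>2"
    by (intro power_mono integral_norm_bound_ennreal fg zero_le)
  also have "\<dots> = (\<integral>\<^sup>+\<omega>. ennreal \<bar>f \<omega>\<bar> * ennreal \<bar>g \<omega>\<bar> \<partial>M)\<^sup>2"
    by (simp add: abs_mult ennreal_mult)
  also have "\<dots> \<le> (\<integral>\<^sup>+\<omega>. (ennreal \<bar>f \<omega>\<bar>)\<^sup>2 \<partial>M) * (\<integral>\<^sup>+\<omega>. (ennreal \<bar>g \<omega>\<bar>)\<^sup>2 \<partial>M)"
    by (rule Cauchy_Schwarz_nn_integral) measurable
  finally show ?thesis by (simp add: ennreal_power)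
qed

text \<open>The formula is a statement about one centred square-integrable variable with a score;
  the structure of a sum enters only in verifying these properties. Both sides live in
  \<open>[0, \<infinity>]\<close>, and each inequality is trivial when its upper side is
  infinite.\<close>

theorem (in prob_space) relative_fisher_information_eq_SUP:
  assumes W[measurable]: "random_variable borel W" and ex: "\<exists>\<rho>. is_score M W \<rho>"
    and W2: "integrable M (\<lambda>\<omega>. (W \<omega>)\<^sup>2)" and EW: "expectation W = 0"
  shows "relative_fisher_information M W =
    (SUP \<phi> \<in> stein_class M W. ennreal ((expectation (\<lambda>\<omega>. deriv \<phi> (W \<omega>) - W \<omega> * \<phi> (W \<omega>)))\<^sup>2))"
    (is "?J = ?SUP")
proof -
  define \<rho> where "\<rho> = score M W"
  have \<rho>: "is_score M W \<rho>"
    unfolding \<rho>_def score_def using ex by (rule someI_ex)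
  then have \<rho>m[measurable]: "\<rho> \<in> borel_measurable borel" and \<rho>i: "integrable M (\<lambda>\<omega>. \<rho> (W \<omega>))"
    by (auto simp: is_score_def)
  have W1: "integrable M W"
    using W2 by (rule square_integrable_imp_integrable[rotated]) simp
  define h where "h x = \<rho> x + x" for x
  have [measurable]: "h \<in> borel_measurable borel" unfolding h_def by measurable
  have hi: "integrable M (\<lambda>\<omega>. h (W \<omega>))"
    unfolding h_def using \<rho>i W1 by simp
  have J: "?J = (\<integral>\<^sup>+\<omega>. ennreal ((h (W \<omega>))\<^sup>2) \<partial>M)"
    by (simp add: relative_fisher_information_def h_def \<rho>_def)
  \<comment> \<open>A constant is not a test function; the extended identity applied to 1 shows that
    the score has mean 0.\<close>
  have "expectation (\<lambda>\<omega>. \<rho> (W \<omega>) * 1) = - expectation (\<lambda>\<omega>. 0)"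
    by (rule score_by_parts[OF W \<rho>, where \<phi> = "\<lambda>_. 1"]) (use \<rho>i in auto)
  then have Eh: "expectation (\<lambda>\<omega>. h (W \<omega>)) = 0"
    unfolding h_def using \<rho>i W1 EW by simp
  have stein: "expectation (\<lambda>\<omega>. \<phi>' (W \<omega>) - W \<omega> * \<phi> (W \<omega>)) = - expectation (\<lambda>\<omega>. h (W \<omega>) * \<phi> (W \<omega>))"
    if D: "\<And>x. (\<phi> has_real_derivative \<phi>' x) (at x)" and "integrable M (\<lambda>\<omega>. \<phi> (W \<omega>))"
      "integrable M (\<lambda>\<omega>. \<phi>' (W \<omega>))" "integrable M (\<lambda>\<omega>. \<rho> (W \<omega>) * \<phi> (W \<omega>))" "integrable M (\<lambda>\<omega>. W \<omega> * \<phi> (W \<omega>))"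
    for \<phi> \<phi>'
    using that score_by_parts[OF W \<rho> D] unfolding h_def by (simp add: distrib_right)
  show ?thesis
  proof (rule antisym)
    show "?SUP \<le> ?J"
    proof (rule SUP_least)
      fix \<phi> assume "\<phi> \<in> stein_class M W"
      then have D: "(\<phi> has_real_derivative deriv \<phi> x) (at x)"
        and \<phi>i: "integrable M (\<lambda>\<omega>. \<phi> (W \<omega>))" "integrable M (\<lambda>\<omega>. (\<phi> (W \<omega>))\<^sup>2)" "integrable M (\<lambda>\<omega>. deriv \<phi> (W \<omega>))"
        and \<phi>1: "expectation (\<lambda>\<omega>. (\<phi> (W \<omega>))\<^sup>2) \<le> 1" for x
        by (auto simp: stein_class_def DERIV_deriv_iff_real_differentiable)
      have [measurable]: "\<phi> \<in> borel_measurable borel"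
        by (intro borel_measurable_continuous_onI continuous_at_imp_continuous_on ballI DERIV_isCont[OF D])
      show "ennreal ((expectation (\<lambda>\<omega>. deriv \<phi> (W \<omega>) - W \<omega> * \<phi> (W \<omega>)))\<^sup>2) \<le> ?J"
      \<comment> \<open>When \<open>?J\<close> is finite, \<open>h(W)\<close> is square integrable,
        which yields the integrability of \<open>\<rho>(W) * \<phi>(W)\<close> that integration by
        parts demands.\<close>
      proof (cases "?J = \<infinity>")
        case False
        then have h2: "integrable M (\<lambda>\<omega>. (h (W \<omega>))\<^sup>2)"
          unfolding J by (intro integrableI_bounded) (auto simp: less_top)
        have W\<phi>: "integrable M (\<lambda>\<omega>. W \<omega> * \<phi> (W \<omega>))" and h\<phi>: "integrable M (\<lambda>\<omega>. h (W \<omega>) * \<phi> (W \<omega>))"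
          by (rule integrable_mult_of_square_integrable; use \<phi>i W2 h2 in simp)+
        have "integrable M (\<lambda>\<omega>. \<rho> (W \<omega>) * \<phi> (W \<omega>))"
          using Bochner_Integration.integrable_diff[OF h\<phi> W\<phi>] by (simp add: h_def algebra_simps)
        then have "ennreal ((expectation (\<lambda>\<omega>. deriv \<phi> (W \<omega>) - W \<omega> * \<phi> (W \<omega>)))\<^sup>2)
            = ennreal ((expectation (\<lambda>\<omega>. h (W \<omega>) * \<phi> (W \<omega>)))\<^sup>2)"
          using stein[OF D \<phi>i(1,3) _ W\<phi>] by simp
        also have "\<dots> \<le> ?J * (\<integral>\<^sup>+\<omega>. ennreal ((\<phi> (W \<omega>))\<^sup>2) \<partial>M)"
          unfolding J by (rule expectation_mult_square_le[OF _ _ h\<phi>]) measurable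
        also have "\<dots> \<le> ?J * 1"
          using \<phi>1 by (intro mult_left_mono) (simp_all add: nn_integral_eq_integral[OF \<phi>i(2)])
        finally show ?thesis by simp
      qed simp
    qed
    show "?J \<le> ?SUP"
    proof (cases "?SUP = \<infinity>")
      case False
      then obtain S where S: "S \<ge> 0" "?SUP = ennreal S"
        by (cases ?SUP) auto
      have bound: "(expectation (\<lambda>\<omega>. deriv \<phi> (W \<omega>) - W \<omega> * \<phi> (W \<omega>)))\<^sup>2 \<le> S"
        if "\<phi> \<in> stein_class M W" for \<phi>
        using SUP_upper[OF that, of "\<lambda>\<phi>. ennreal ((expectation (\<lambda>\<omega>. deriv \<phi> (W \<omega>) - W \<omega> * \<phi> (W \<omega>)))\<^sup>2)"] S
        by simp
      (* Since E[h(W)] = 0, the test function may be centred and then normalised. *)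
      have C1: "(expectation (\<lambda>\<omega>. h (W \<omega>) * \<phi> (W \<omega>)))\<^sup>2 \<le> S * expectation (\<lambda>\<omega>. (\<phi> (W \<omega>))\<^sup>2)"
        if D: "\<And>x. (\<phi> has_real_derivative \<phi>' x) (at x)" and B: "\<And>x. \<bar>\<phi> x\<bar> \<le> B" and B': "\<And>x. \<bar>\<phi>' x\<bar> \<le> B'"
        for \<phi> \<phi>' :: "real \<Rightarrow> real" and B B'
      proof -
        have [measurable]: "\<phi> \<in> borel_measurable borel" "\<phi>' \<in> borel_measurable borel"
          using borel_measurable_DERIV[OF D]
          by (auto intro!: borel_measurable_continuous_onI continuous_at_imp_continuous_on DERIV_isCont[OF D])
        have \<phi>i: "integrable M (\<lambda>\<omega>. \<phi> (W \<omega>))" and \<phi>'i: "integrable M (\<lambda>\<omega>. \<phi>' (W \<omega>))"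
          by (rule integrable_const_bound[where B = B] integrable_const_bound[where B = B'],
              use B B' in simp, measurable)+
        have mult: "integrable M (\<lambda>\<omega>. u \<omega> * \<phi> (W \<omega>))" if "integrable M u" for u
          by (rule integrable_mult_bounded[OF that _ B]) measurable
        define m where "m = expectation (\<lambda>\<omega>. \<phi> (W \<omega>))"
        define v where "v = expectation (\<lambda>\<omega>. (\<phi> (W \<omega>) - m)\<^sup>2)"
        have "integrable M (\<lambda>\<omega>. (\<phi> (W \<omega>))\<^sup>2)"
          unfolding power2_eq_square by (rule mult[OF \<phi>i])
        then have v_eq: "v = expectation (\<lambda>\<omega>. (\<phi> (W \<omega>))\<^sup>2) - m\<^sup>2"
          unfolding v_def m_def by (rule variance_eq[OF \<phi>i])
        have sq: "integrable M (\<lambda>\<omega>. (\<phi> (W \<omega>) - m)\<^sup>2)"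
          unfolding power2_diff
          using \<open>integrable M (\<lambda>\<omega>. (\<phi> (W \<omega>))\<^sup>2)\<close> \<phi>i by simp
        have "v \<ge> 0" by (simp add: v_def)
        have center: "expectation (\<lambda>\<omega>. h (W \<omega>) * (\<phi> (W \<omega>) - m)) = expectation (\<lambda>\<omega>. h (W \<omega>) * \<phi> (W \<omega>))"
          unfolding right_diff_distrib using mult[OF hi] hi Eh by simp
        have "(expectation (\<lambda>\<omega>. h (W \<omega>) * \<phi> (W \<omega>)))\<^sup>2 \<le> S * v"
        \<comment> \<open>With variance 0 normalisation is impossible, but then
          \<open>\<phi>(W)\<close> is almost surely constant and the centred expectation is
          0.\<close>
        proof (cases "v = 0")
          case True
          then have "AE \<omega> in M. (\<phi> (W \<omega>) - m)\<^sup>2 = 0"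
            using integral_nonneg_eq_0_iff_AE[OF sq] by (simp add: v_def)
          then have "AE \<omega> in M. h (W \<omega>) * (\<phi> (W \<omega>) - m) = 0"
            by eventually_elim simp
          then have "expectation (\<lambda>\<omega>. h (W \<omega>) * (\<phi> (W \<omega>) - m)) = 0"
            by (rule integral_eq_zero_AE)
          then show ?thesis using center True by simp
        next
          case False
          with \<open>v \<ge> 0\<close> have "v > 0" by simp
          define \<psi> where "\<psi> x = (\<phi> x - m) / sqrt v" for x
          define \<psi>' where "\<psi>' x = \<phi>' x / sqrt v" for x
          have D\<psi>: "(\<psi> has_real_derivative \<psi>' x) (at x)" for x
            using DERIV_cdivide[OF DERIV_diff[OF D[of x] DERIV_const[of m]], of "sqrt v"]
            by (simp add: \<psi>_def[abs_def] \<psi>'_def)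
          then have deriv: "deriv \<psi> = \<psi>'" by (auto intro: DERIV_imp_deriv)
          have \<psi>2: "(\<psi> x)\<^sup>2 = (\<phi> x - m)\<^sup>2 / v" for x
            using \<open>v > 0\<close> by (simp add: \<psi>_def power_divide)
          have mult\<psi>: "integrable M (\<lambda>\<omega>. u \<omega> * \<psi> (W \<omega>))" if "integrable M u" for u
            using mult[OF that] that by (simp add: \<psi>_def right_diff_distrib)
          have \<psi>i: "integrable M (\<lambda>\<omega>. \<psi> (W \<omega>))" and \<psi>'i: "integrable M (\<lambda>\<omega>. \<psi>' (W \<omega>))"
            using \<phi>i \<phi>'i by (simp_all add: \<psi>_def \<psi>'_def)
          have "expectation (\<lambda>\<omega>. \<psi> (W \<omega>)) = 0"
            unfolding \<psi>_def using \<phi>i by (simp add: m_def prob_space)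
          moreover have "expectation (\<lambda>\<omega>. (\<psi> (W \<omega>))\<^sup>2) = 1"
            unfolding \<psi>2 using \<open>v > 0\<close> by (simp add: v_def[symmetric])
          moreover have "integrable M (\<lambda>\<omega>. (\<psi> (W \<omega>))\<^sup>2)"
            unfolding \<psi>2 using sq by simp
          moreover have "\<forall>x. \<psi> differentiable at x"
            using D\<psi> real_differentiable_def by blast
          ultimately have "\<psi> \<in> stein_class M W"
            using \<psi>i \<psi>'i by (simp add: stein_class_def deriv)
          from bound[OF this] have "(expectation (\<lambda>\<omega>. h (W \<omega>) * \<psi> (W \<omega>)))\<^sup>2 \<le> S"
            unfolding deriv using stein[OF D\<psi> \<psi>i \<psi>'i mult\<psi>[OF \<rho>i] mult\<psi>[OF W1]] by simp
          also have "expectation (\<lambda>\<omega>. h (W \<omega>) * \<psi> (W \<omega>)) = expectation (\<lambda>\<omega>. h (W \<omega>) * \<phi> (W \<omega>)) / sqrt v"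
            unfolding \<psi>_def times_divide_eq_right integral_divide_zero center ..
          finally show ?thesis
            using \<open>v > 0\<close> by (simp add: power_divide field_simps)
        qed
        \<comment> \<open>The variance is at most the second moment.\<close>
        also have "S * v \<le> S * expectation (\<lambda>\<omega>. (\<phi> (W \<omega>))\<^sup>2)"
          using S(1) by (intro mult_left_mono) (simp add: v_eq)
        finally show ?thesis .
      qed
      have "?J \<le> ennreal S"
        unfolding J
      proof (rule nn_integral_square_le_of_truncations[OF hi _ S(1)])
        fix k :: nat
        show "(expectation (\<lambda>\<omega>. h (W \<omega>) * max (- real k) (min (real k) (h (W \<omega>)))))\<^sup>2
            \<le> S * expectation (\<lambda>\<omega>. (max (- real k) (min (real k) (h (W \<omega>))))\<^sup>2)"
          by (rule expectation_square_ineq_borel[OF W \<rho> _ hi C1, where g = "\<lambda>x. max (- real k) (min (real k) (h x))" and k = "real k"])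
            auto
      qed
      then show ?thesis using S(2) by simp
    next
      case True
      show ?thesis unfolding True by simp
    qed
  qed
qed

section \<open>Application to normalised sums\<close>

theorem mainTheorem5:
  fixes M :: "'a measure" and X :: "nat \<Rightarrow> 'a \<Rightarrow> real" and n :: nat and W :: "'a \<Rightarrow> real"
  assumes "prob_space M"
    and "n \<ge> 1"
    and "prob_space.indep_vars M (\<lambda>_. borel) X {1..n}"
    and "\<And>i. i \<in> {1..n} \<Longrightarrow> \<exists>f. distributed M lborel (X i) f"
    and "\<And>i. i \<in> {1..n} \<Longrightarrow> integrable M (X i)"
    and "\<And>i. i \<in> {1..n} \<Longrightarrow> prob_space.expectation M (X i) = 0"
    and "\<And>i. i \<in> {1..n} \<Longrightarrow> prob_space.variance M (X i) = 1"
    and "\<And>i. i \<in> {1..n} \<Longrightarrow> \<exists>\<tau>. is_stein_factor M (X i) \<tau>"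
    and "\<And>i. i \<in> {1..n} \<Longrightarrow> \<exists>\<rho>. is_score M (X i) \<rho>"
    and "W = (\<lambda>\<omega>. 1 / sqrt (real n) * (\<Sum>i = 1..n. X i \<omega>))"
  shows "relative_fisher_information M W =
    (SUP \<phi> \<in> stein_class M W.
       ennreal ((prob_space.expectation M (\<lambda>\<omega>. deriv \<phi> (W \<omega>) - W \<omega> * \<phi> (W \<omega>)))\<^sup>2))"
proof -
  interpret prob_space M by fact
  note W = assms(10)
  have Xm[measurable]: "random_variable borel (X i)" if "i \<in> {1..n}" for i
    using assms(5)[OF that] by (rule borel_measurable_integrable)
  \<comment> \<open>A non-integrable function has Bochner integral 0, so variance 1 with mean 0
    forces square integrability.\<close>
  have X2: "integrable M (\<lambda>\<omega>. (X i \<omega>)\<^sup>2)" if "i \<in> {1..n}" for i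
  proof (rule ccontr)
    assume "\<not> integrable M (\<lambda>\<omega>. (X i \<omega>)\<^sup>2)"
    then have "variance (X i) = 0"
      using assms(6)[OF that] by (simp add: not_integrable_integral_eq)
    with assms(7)[OF that] show False by simp
  qed
  have Wm: "random_variable borel W"
    unfolding W by (intro borel_measurable_times borel_measurable_const borel_measurable_sum Xm)
  have W2: "integrable M (\<lambda>\<omega>. (W \<omega>)\<^sup>2)"
  proof (rule Bochner_Integration.integrable_bound)
    show "integrable M (\<lambda>\<omega>. \<Sum>i=1..n. (X i \<omega>)\<^sup>2)"
      by (rule Bochner_Integration.integrable_sum) (rule X2)
    show "AE \<omega> in M. norm ((W \<omega>)\<^sup>2) \<le> norm (\<Sum>i=1..n. (X i \<omega>)\<^sup>2)"
    proof (rule AE_I2)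
      fix \<omega>
      \<comment> \<open>Cauchy-Schwarz: the number of terms \<open>n\<close> is cancelled by the
        normalisation of \<open>W\<close>.\<close>
      have "(\<Sum>i=1..n. X i \<omega>)\<^sup>2 / real n \<le> (\<Sum>i=1..n. (X i \<omega>)\<^sup>2)"
        using sum_squared_le_sum_of_squares[of "\<lambda>i. X i \<omega>" "{1..n}"] \<open>n \<ge> 1\<close> by (simp add: field_simps)
      moreover have "(W \<omega>)\<^sup>2 = (\<Sum>i=1..n. X i \<omega>)\<^sup>2 / real n"
        by (simp add: W power_divide)
      ultimately show "norm ((W \<omega>)\<^sup>2) \<le> norm (\<Sum>i=1..n. (X i \<omega>)\<^sup>2)"
        by (simp add: sum_nonneg)
    qed
  qed (use Wm in simp)
  have EW: "expectation W = 0"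
    unfolding W using assms(5,6) by (simp add: Bochner_Integration.integral_sum)
  \<comment> \<open>\<open>X 1\<close> supplies the score and the remaining terms form the
    independent summand. For \<open>n = 1\<close> that summand is the empty sum 0.\<close>
  have I: "{1..n} = insert 1 {2..n}"
    using \<open>n \<ge> 1\<close> by auto
  obtain \<rho> where \<rho>: "is_score M (X 1) \<rho>"
    using assms(9)[of 1] \<open>n \<ge> 1\<close> by auto
  have "indep_var borel (X 1) borel (\<lambda>\<omega>. \<Sum>i\<in>{2..n}. X i \<omega>)"
    using assms(3) unfolding I by (intro indep_vars_sum) auto
  from score_exists_add_indep[OF this \<rho>, of "1 / sqrt (real n)"] \<open>n \<ge> 1\<close>
  have "\<exists>\<sigma>. is_score M (\<lambda>\<omega>. 1 / sqrt (real n) * (X 1 \<omega> + (\<Sum>i\<in>{2..n}. X i \<omega>))) \<sigma>"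
    by simp
  then have "\<exists>\<sigma>. is_score M W \<sigma>"
    unfolding W I by simp
  then show ?thesis
    by (rule relative_fisher_information_eq_SUP[OF Wm _ W2 EW])
qed

end
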